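(* Let $Y$ be a quasi-malleable nonsingular real algebraic variety. Let $X$ be a real algebraic variety (possibly singular), and $f:D\to Y$ a continuous map defined on an arbitrary subset $D$ of $X$. Assume that there exists a regular map $f_0:X\to Y$ with $f_0|_D$ homotopic to $f$. Then $f$ can be approximated in the compact-open topology by regular maps from $X$ to $Y$.
   Context: A real algebraic variety is a ringed space with structure sheaf of $\mathbb{R}$-algebras of $\mathbb{R}$-valued functions which is isomorphic to a Zariski locally closed subset of some real projective space $\mathbb{P}^n(\mathbb{R})$, with the Zariski topology and the sheaf of regular functions; each such variety is affine, i.e. isomorphic to an algebraic subset of some $\mathbb{R}^n$. Morphisms are called regular maps: for algebraic sets $X\subset\mathbb{R}^n$, $Y\subset\mathbb{R}^p$ and $U\subset X$ Zariski open, a function $U\to\mathbb{R}$ is regular iff it equals $P/Q$ on $U$ for polynomials $P,Q$ with $Q$ nowhere zero on $U$, and a map $U\to Y$ is regular iff its components are. Unless stated otherwise, topological notions (continuity, homotopy, ...) refer to the Euclidean topology. Smooth means $\mathcal{C}^\infty$. $\mathcal{C}(D,Y)$ is the space of continuous maps $D\to Y$ with the compact-open topology. A continuous map $f:D\to Y$ can be approximated in the compact-open topology by regular maps from $X$ to $Y$ if for every open neighborhood $\mathcal{U}\subset\mathcal{C}(D,Y)$ of $f$ there is a regular map $g:X\to Y$ with $g|_D\in\mathcal{U}$. Vector bundles are real; algebraic vector bundles are those algebraically isomorphic to algebraic subbundles of product bundles $Y\times\mathbb{R}^n$ (Bochnak–Coste–Roy). For a vector bundle $p:E\to Y$, $E_y=p^{-1}(y)$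 and $0_y$ is the zero vector of $E_y$. $\Omega(Y)$ denotes the collection of all relatively compact open subsets of $Y$. A quasi-spray $(E,p,\{s_V\},\{\tau_V\})$ for $Y$ consists of an algebraic vector bundle $p:E\to Y$ and two collections indexed by $V\in\Omega(Y)$, where $s_V:E\to Y$ is a regular map and $\tau_V:V\to E$ is a smooth map such that $s_V(\tau_V(y))=y$ and $p(\tau_V(y))=y$ for all $y\in V$. It is dominating if for every $V\in\Omega(Y)$ and every $y\in V$ the map $E_y\to Y$, $v\mapsto s_V(v+\tau_V(y))$ is a submersion at $0_y$. $Y$ is quasi-malleable if it admits a dominating quasi-spray. *)

theory Defs
  imports "HOL-Analysis.Analysis"
begin

section \<open>Real algebraic sets and regular maps\<close>

text \<open>
  Every real algebraic variety is affine, so varieties are represented by algebraic subsets of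
  Euclidean spaces. The Euclidean space is an arbitrary type of class \<open>euclidean_space\<close>; its
  dimension is thus arbitrary, and polynomials are the coordinate-free
  \<^const>\<open>real_polynomial_function\<close> of the library. Maps between varieties are total HOL functions
  whose values outside the domain are irrelevant.
\<close>

definition algebraic_set :: "'a::euclidean_space set \<Rightarrow> bool" where
  "algebraic_set X \<longleftrightarrow>
     (\<exists>\<P>. (\<forall>P\<in>\<P>. real_polynomial_function P) \<and> X = {x. \<forall>P\<in>\<P>. P x = 0})"

definition zariski_open_in :: "'a::euclidean_space set \<Rightarrow> 'a set \<Rightarrow> bool" where
  "zariski_open_in X U \<longleftrightarrow> (\<exists>A. algebraic_set A \<and> U = X - A)"

text \<open>In the next two definitions \<open>U\<close> is meant to be Zariski open in an algebraic set.\<close>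

definition regular_function :: "'a::euclidean_space set \<Rightarrow> ('a \<Rightarrow> real) \<Rightarrow> bool" where
  "regular_function U f \<longleftrightarrow>
     (\<exists>P Q. real_polynomial_function P \<and> real_polynomial_function Q \<and>
            (\<forall>x\<in>U. Q x \<noteq> 0 \<and> f x = P x / Q x))"

definition regular_map ::
    "'a::euclidean_space set \<Rightarrow> 'b::euclidean_space set \<Rightarrow> ('a \<Rightarrow> 'b) \<Rightarrow> bool" where
  "regular_map U Y f \<longleftrightarrow> f \<in> U \<rightarrow> Y \<and> (\<forall>b\<in>Basis. regular_function U (\<lambda>x. f x \<bullet> b))"

definition tangent_space :: "'a::euclidean_space set \<Rightarrow> 'a \<Rightarrow> 'a set" where
  "tangent_space X x =
     {v. \<forall>P. real_polynomial_function P \<and> (\<forall>z\<in>X. P z = 0) \<longrightarrow> frechet_derivative P (at x) v = 0}"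

text \<open>
  Nonsingularity (regularity of the local ring at each point) by the Jacobian criterion: \<open>c\<close>
  polynomials vanishing on \<open>X\<close> cut out \<open>X\<close> in a Zariski neighbourhood of \<open>x\<close> and have linearly
  independent differentials at \<open>x\<close>. The codimension \<open>c\<close> may depend on \<open>x\<close>.
\<close>

definition nonsingular :: "'a::euclidean_space set \<Rightarrow> bool" where
  "nonsingular X \<longleftrightarrow>
     (\<forall>x\<in>X. \<exists>(c::nat) (P :: nat \<Rightarrow> 'a \<Rightarrow> real) U.
        (\<forall>i<c. real_polynomial_function (P i) \<and> (\<forall>z\<in>X. P i z = 0)) \<and>
        zariski_open_in UNIV U \<and> x \<in> U \<and>
        X \<inter> U = {z\<in>U. \<forall>i<c. P i z = 0} \<and>
        (\<forall>u :: nat \<Rightarrow> real.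
           (\<forall>v. (\<Sum>i<c. u i * frechet_derivative (P i) (at x) v) = 0) \<longrightarrow> (\<forall>i<c. u i = 0)))"

section \<open>Smooth maps and submersions\<close>

text \<open>\<open>Ck_on k U f\<close>: the map \<open>f\<close> is of class \<open>C\<^sup>k\<close> on the open set \<open>U\<close>.\<close>

primrec Ck_on ::
    "nat \<Rightarrow> 'a::euclidean_space set \<Rightarrow> ('a \<Rightarrow> 'b::euclidean_space) \<Rightarrow> bool" where
  "Ck_on 0 U f \<longleftrightarrow> continuous_on U f"
| "Ck_on (Suc k) U f \<longleftrightarrow>
     (\<forall>x\<in>U. f differentiable (at x)) \<and>
     (\<forall>v. Ck_on k U (\<lambda>x. frechet_derivative f (at x) v))"

text \<open>A map on an arbitrary subset is smooth if it extends locally to smooth maps on open sets.\<close>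

definition smooth_map ::
    "'a::euclidean_space set \<Rightarrow> 'b::euclidean_space set \<Rightarrow> ('a \<Rightarrow> 'b) \<Rightarrow> bool" where
  "smooth_map V E f \<longleftrightarrow>
     f \<in> V \<rightarrow> E \<and>
     (\<forall>x\<in>V. \<exists>U F. open U \<and> x \<in> U \<and> (\<forall>k. Ck_on k U F) \<and> (\<forall>z\<in>U \<inter> V. F z = f z))"

text \<open>
  For nonsingular \<open>M\<close> the restriction of \<open>h'\<close> to \<open>tangent_space M a\<close> is determined by \<open>h\<close>; it is
  the differential of \<open>h\<close> at \<open>a\<close>.
\<close>

definition submersion_at ::
    "'a::euclidean_space set \<Rightarrow> 'b::euclidean_space set \<Rightarrow> ('a \<Rightarrow> 'b) \<Rightarrow> 'a \<Rightarrow> bool" where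
  "submersion_at M N h a \<longleftrightarrow>
     (\<exists>h'. (h has_derivative h') (at a within M) \<and>
           h' ` tangent_space M a = tangent_space N (h a))"

section \<open>Algebraic vector bundles\<close>

record ('e, 'y) vbundle =
  total_space :: "'e set"
  proj :: "'e \<Rightarrow> 'y"
  zero_vec :: "'y \<Rightarrow> 'e"
  vadd :: "'e \<Rightarrow> 'e \<Rightarrow> 'e"
  vscale :: "real \<Rightarrow> 'e \<Rightarrow> 'e"

definition fibre :: "('e, 'y) vbundle \<Rightarrow> 'y \<Rightarrow> 'e set" where
  "fibre E y = {u \<in> total_space E. proj E u = y}"

definition vector_space_fibres :: "'y set \<Rightarrow> ('e, 'y) vbundle \<Rightarrow> bool" where
  "vector_space_fibres Y E \<longleftrightarrow>
     proj E \<in> total_space E \<rightarrow> Y \<and>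
     (\<forall>y\<in>Y. let F = fibre E y; z = zero_vec E y; add = vadd E; scale = vscale E in
        z \<in> F \<and>
        (\<forall>u\<in>F. \<forall>v\<in>F. add u v \<in> F \<and> add u v = add v u) \<and>
        (\<forall>u\<in>F. \<forall>v\<in>F. \<forall>w\<in>F. add (add u v) w = add u (add v w)) \<and>
        (\<forall>u\<in>F. add z u = u \<and> (\<exists>v\<in>F. add v u = z)) \<and>
        (\<forall>a. \<forall>u\<in>F. scale a u \<in> F) \<and>
        (\<forall>u\<in>F. scale 1 u = u) \<and>
        (\<forall>a b. \<forall>u\<in>F. scale a (scale b u) = scale (a * b) u \<and>
                         scale (a + b) u = add (scale a u) (scale b u)) \<and>
        (\<forall>a. \<forall>u\<in>F. \<forall>v\<in>F. scale a (add u v) = add (scale a u) (scale a v)))"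

text \<open>Algebraic isomorphism over the identity of the base.\<close>

definition vb_isomorphic ::
    "('e::euclidean_space, 'y) vbundle \<Rightarrow> ('f::euclidean_space, 'y) vbundle \<Rightarrow> bool" where
  "vb_isomorphic E F \<longleftrightarrow>
     (\<exists>\<phi> \<psi>.
        regular_map (total_space E) (total_space F) \<phi> \<and>
        regular_map (total_space F) (total_space E) \<psi> \<and>
        (\<forall>u\<in>total_space E. \<psi> (\<phi> u) = u) \<and>
        (\<forall>w\<in>total_space F. \<phi> (\<psi> w) = w) \<and>
        (\<forall>u\<in>total_space E. proj F (\<phi> u) = proj E u) \<and>
        (\<forall>u\<in>total_space E. \<forall>v\<in>total_space E. proj E u = proj E v \<longrightarrow>
            \<phi> (vadd E u v) = vadd F (\<phi> u) (\<phi> v)) \<and>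
        (\<forall>a. \<forall>u\<in>total_space E. \<phi> (vscale E a u) = vscale F a (\<phi> u)))"

text \<open>A subset of a product bundle, with the fibrewise operations of the product.\<close>

definition product_sub :: "('y \<times> 'k::real_vector) set \<Rightarrow> ('y \<times> 'k, 'y) vbundle" where
  "product_sub S =
     \<lparr> total_space = S,
       proj = fst,
       zero_vec = (\<lambda>y. (y, 0)),
       vadd = (\<lambda>u v. (fst u, snd u + snd v)),
       vscale = (\<lambda>a u. (fst u, a *\<^sub>R snd u)) \<rparr>"

text \<open>
  Algebraic subbundles of the product bundle of \<open>Y\<close> with \<open>'k\<close>, where \<open>'k\<close> stands for
  \<open>\<real>\<^sup>n\<close>: Zariski closed and Zariski locally trivial. The model fibre of a local trivialization
  is a subspace \<open>W\<close> of \<open>'k\<close>, since the rank may vary with the component of \<open>Y\<close>.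
\<close>

definition algebraic_subbundle ::
    "'y::euclidean_space set \<Rightarrow> ('y \<times> 'k::euclidean_space) set \<Rightarrow> bool" where
  "algebraic_subbundle Y S \<longleftrightarrow>
     S \<subseteq> Y \<times> UNIV \<and> algebraic_set S \<and>
     (\<forall>y\<in>Y. subspace {v. (y, v) \<in> S}) \<and>
     (\<forall>y\<in>Y. \<exists>U (W :: 'k set). zariski_open_in Y U \<and> y \<in> U \<and> subspace W \<and>
        vb_isomorphic (product_sub (S \<inter> (U \<times> UNIV))) (product_sub (U \<times> W)))"

definition algebraic_vector_bundle ::
    "'k::euclidean_space itself \<Rightarrow> 'y::euclidean_space set \<Rightarrow>
     ('e::euclidean_space, 'y) vbundle \<Rightarrow> bool" where
  "algebraic_vector_bundle _ Y E \<longleftrightarrow>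
     algebraic_set (total_space E) \<and>
     regular_map (total_space E) Y (proj E) \<and>
     vector_space_fibres Y E \<and>
     (\<exists>S :: ('y \<times> 'k) set. algebraic_subbundle Y S \<and> vb_isomorphic E (product_sub S))"

section \<open>Quasi-sprays\<close>

definition rel_compact_opens :: "'y::euclidean_space set \<Rightarrow> 'y set set" where
  "rel_compact_opens Y =
     {V. openin (top_of_set Y) V \<and> compactin (top_of_set Y) (top_of_set Y closure_of V)}"

definition quasi_spray ::
    "'k::euclidean_space itself \<Rightarrow> 'y::euclidean_space set \<Rightarrow> ('e::euclidean_space, 'y) vbundle \<Rightarrow>
     ('y set \<Rightarrow> 'e \<Rightarrow> 'y) \<Rightarrow> ('y set \<Rightarrow> 'y \<Rightarrow> 'e) \<Rightarrow> bool" where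
  "quasi_spray k Y E s \<tau> \<longleftrightarrow>
     algebraic_vector_bundle k Y E \<and>
     (\<forall>V\<in>rel_compact_opens Y.
        regular_map (total_space E) Y (s V) \<and>
        smooth_map V (total_space E) (\<tau> V) \<and>
        (\<forall>y\<in>V. s V (\<tau> V y) = y \<and> proj E (\<tau> V y) = y))"

definition dominating ::
    "'y::euclidean_space set \<Rightarrow> ('e::euclidean_space, 'y) vbundle \<Rightarrow>
     ('y set \<Rightarrow> 'e \<Rightarrow> 'y) \<Rightarrow> ('y set \<Rightarrow> 'y \<Rightarrow> 'e) \<Rightarrow> bool" where
  "dominating Y E s \<tau> \<longleftrightarrow>
     (\<forall>V\<in>rel_compact_opens Y. \<forall>y\<in>V.
        submersion_at (fibre E y) Y (\<lambda>v. s V (vadd E v (\<tau> V y))) (zero_vec E y))"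

text \<open>
  HOL cannot quantify existentially over the dimensions of the Euclidean spaces \<open>'e\<close> (containing the
  total space) and \<open>'k\<close> (the fibre of the ambient product bundle), so they are type parameters.
  A theorem assuming \<open>quasi_malleable\<close> with both type variables free holds for all dimensions.
\<close>

definition quasi_malleable ::
    "'e::euclidean_space itself \<Rightarrow> 'k::euclidean_space itself \<Rightarrow> 'y::euclidean_space set \<Rightarrow> bool" where
  "quasi_malleable _ k Y \<longleftrightarrow>
     (\<exists>(E :: ('e, 'y) vbundle) s \<tau>. quasi_spray k Y E s \<tau> \<and> dominating Y E s \<tau>)"

section \<open>The compact-open topology\<close>

text \<open>\<open>\<C>(D,Y)\<close>; functions are normalized to be \<^const>\<open>undefined\<close> outside \<open>D\<close>.\<close>

definition continuous_maps ::
    "'a::topological_space set \<Rightarrow> 'b::topological_space set \<Rightarrow> ('a \<Rightarrow> 'b) set" where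
  "continuous_maps D Y = {f \<in> D \<rightarrow>\<^sub>E Y. continuous_on D f}"

definition compact_open_topology ::
    "'a::topological_space set \<Rightarrow> 'b::topological_space set \<Rightarrow> ('a \<Rightarrow> 'b) topology" where
  "compact_open_topology D Y =
     topology_generated_by
       {{f \<in> continuous_maps D Y. f ` K \<subseteq> W} | K W.
          compact K \<and> K \<subseteq> D \<and> openin (top_of_set Y) W}"

definition approximable_by_regular_maps ::
    "'a::euclidean_space set \<Rightarrow> 'a set \<Rightarrow> 'b::euclidean_space set \<Rightarrow> ('a \<Rightarrow> 'b) \<Rightarrow> bool" where
  "approximable_by_regular_maps X D Y f \<longleftrightarrow>
     (\<forall>\<U>. openin (compact_open_topology D Y) \<U> \<and> restrict f D \<in> \<U> \<longrightarrow>
        (\<exists>g. regular_map X Y g \<and> restrict g D \<in> \<U>))"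

end

theory Submission
  imports Defs
begin

text \<open>
  Transport the quasi-spray along \<open>E \<cong> S \<subseteq> Y \<times> \<real>\<^sup>k\<close>. On a relatively compact open \<open>V\<close> it becomes a
  regular map \<open>T : S \<rightarrow> Y\<close> with a continuous section \<open>\<omega>\<close> of \<open>S\<close> over \<open>V\<close> such that \<open>T (y, \<omega> y) = y\<close>,
  and domination says that the derivative \<open>D\<^sub>y\<close> of \<open>T (y, \<cdot>)\<close> at \<open>\<omega> y\<close> maps the fibre \<open>S\<^sub>y\<close> onto the
  tangent space of \<open>Y\<close> at \<open>y\<close> (\<open>dominating_quasi_spray_on_subbundle\<close>). Let \<open>h : K \<rightarrow> Y\<close> be continuous on a
  compact \<open>K \<subseteq> X\<close> and let \<open>g : X \<rightarrow> Y\<close> be a regular map close to \<open>h\<close> on \<open>K\<close>. The spray is used to correct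
  \<open>g\<close>: choose a regular \<open>w\<close> with \<open>w x\<close> in the fibre over \<open>g x\<close> and replace \<open>g\<close> by \<open>x \<mapsto> T (g x, w x)\<close>,
  which is again a regular map \<open>X \<rightarrow> Y\<close>.

  Solving \<open>T (g x, w x) = h x\<close> exactly would call for an implicit function theorem with parameters.
  One step of Newton's method is enough instead: it suffices to have a continuous \<open>v\<close> near the diagonal
  of \<open>Y \<times> Y\<close> with \<open>dist (T (y, v y z)) z \<le> dist y z / 2\<close> (\<open>approximate_lift_near_diagonal\<close>).
  Approximating \<open>v (g x) (h x)\<close> by a regular \<open>w\<close> then brings \<open>g\<close> closer to \<open>h\<close> by the factor \<open>3/4\<close>
  (\<open>regular_approximation_contracts\<close>). By iteration, as soon as some regular map is within a distance \<open>d\<close>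
  of \<open>h\<close> on \<open>K\<close>, regular maps approximate \<open>h\<close> on \<open>K\<close> arbitrarily well. The radius \<open>d\<close> is uniform
  for all \<open>h\<close> with values in a fixed compact set, so one can walk from \<open>f\<^sub>0\<close> to \<open>f\<close> along the homotopy in
  finitely many steps, each shorter than \<open>d\<close> (\<open>regular_approximation_along_homotopy\<close>).

  The linear problem behind \<open>v\<close> is to find \<open>\<eta> \<in> S\<^sub>y\<close> with \<open>D\<^sub>y \<eta> \<approx> z - y\<close>. Near a point \<open>p\<close> this is solved
  as at \<open>p\<close> itself, because a secant \<open>z - y\<close> of \<open>Y\<close> near \<open>p\<close> is tangent to \<open>Y\<close> at \<open>p\<close> up to a small
  relative error (\<open>secants_approximately_tangent\<close>). The condition on \<open>\<eta>\<close> is convex, so a partition of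
  unity glues the local solutions. Both here and in the approximation of continuous sections, the elements
  of the fibres are moved to nearby fibres by polynomial sections of \<open>S\<close>: every point of \<open>S\<close> lies on
  such a section, defined over all of \<open>Y\<close> (\<open>algebraic_subbundle_polynomial_section\<close>).
\<close>

section \<open>Calculus of regular functions\<close>

lemma regular_function_polynomial:
  "real_polynomial_function p \<Longrightarrow> regular_function U p"
  unfolding regular_function_def by (rule exI[of _ p], rule exI[of _ "\<lambda>x. 1"]) auto

lemma regular_function_const: "regular_function U (\<lambda>x. c)"
  by (rule regular_function_polynomial) auto

lemma regular_function_cong:
  "regular_function U f \<Longrightarrow> (\<And>x. x \<in> U \<Longrightarrow> g x = f x) \<Longrightarrow> regular_function U g"
  unfolding regular_function_def by metis

lemma regular_function_subset:
  "regular_function U f \<Longrightarrow> V \<subseteq> U \<Longrightarrow> regular_function V f"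
  unfolding regular_function_def by blast

lemma regular_function_add:
  assumes "regular_function U f" "regular_function U g"
  shows "regular_function U (\<lambda>x. f x + g x)"
proof -
  obtain P Q P' Q' where *: "real_polynomial_function P" "real_polynomial_function Q"
      "real_polynomial_function P'" "real_polynomial_function Q'"
      "\<forall>x\<in>U. Q x \<noteq> 0 \<and> f x = P x / Q x" "\<forall>x\<in>U. Q' x \<noteq> 0 \<and> g x = P' x / Q' x"
    using assms unfolding regular_function_def by metis
  show ?thesis
    unfolding regular_function_def
    by (rule exI[of _ "\<lambda>x. P x * Q' x + P' x * Q x"], rule exI[of _ "\<lambda>x. Q x * Q' x"])
       (use * in \<open>auto simp: field_simps\<close>)
qed

lemma regular_function_mult:
  assumes "regular_function U f" "regular_function U g"
  shows "regular_function U (\<lambda>x. f x * g x)"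
proof -
  obtain P Q P' Q' where *: "real_polynomial_function P" "real_polynomial_function Q"
      "real_polynomial_function P'" "real_polynomial_function Q'"
      "\<forall>x\<in>U. Q x \<noteq> 0 \<and> f x = P x / Q x" "\<forall>x\<in>U. Q' x \<noteq> 0 \<and> g x = P' x / Q' x"
    using assms unfolding regular_function_def by metis
  show ?thesis
    unfolding regular_function_def
    by (rule exI[of _ "\<lambda>x. P x * P' x"], rule exI[of _ "\<lambda>x. Q x * Q' x"]) (use * in auto)
qed

lemma regular_function_divide:
  assumes "regular_function U f" "regular_function U g" "\<And>x. x \<in> U \<Longrightarrow> g x \<noteq> 0"
  shows "regular_function U (\<lambda>x. f x / g x)"
proof -
  obtain P Q P' Q' where *: "real_polynomial_function P" "real_polynomial_function Q"
      "real_polynomial_function P'" "real_polynomial_function Q'"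
      "\<forall>x\<in>U. Q x \<noteq> 0 \<and> f x = P x / Q x" "\<forall>x\<in>U. Q' x \<noteq> 0 \<and> g x = P' x / Q' x"
    using assms unfolding regular_function_def by metis
  show ?thesis
    unfolding regular_function_def
    by (rule exI[of _ "\<lambda>x. P x * Q' x"], rule exI[of _ "\<lambda>x. Q x * P' x"])
       (use * assms(3) in \<open>auto simp: field_simps\<close>)
qed

lemma regular_function_sum:
  "(\<And>i. i \<in> I \<Longrightarrow> regular_function U (f i)) \<Longrightarrow> regular_function U (\<lambda>x. \<Sum>i\<in>I. f i x)"
  by (induction I rule: infinite_finite_induct)
     (auto intro: regular_function_const regular_function_add)

lemma regular_function_compose_polynomial:
  fixes g :: "'a::euclidean_space \<Rightarrow> 'b::euclidean_space"
  assumes "\<forall>b\<in>Basis. regular_function U (\<lambda>x. g x \<bullet> b)" "real_polynomial_function p"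
  shows "regular_function U (\<lambda>x. p (g x))"
  using assms(2)
proof induction
  case (linear f)
  have "f (g x) = (\<Sum>b\<in>Basis. (g x \<bullet> b) * f b)" for x
  proof -
    interpret bounded_linear f by fact
    have "f (g x) = f (\<Sum>b\<in>Basis. (g x \<bullet> b) *\<^sub>R b)"
      by (simp add: euclidean_representation)
    then show ?thesis
      by (simp add: sum scaleR)
  qed
  then show ?case
    by (auto intro!: regular_function_sum regular_function_mult regular_function_const
             simp: assms(1))
qed (auto intro: regular_function_const regular_function_add regular_function_mult)

lemma regular_function_compose:
  assumes "\<forall>b\<in>Basis. regular_function U (\<lambda>x. g x \<bullet> b)" "g ` U \<subseteq> Z" "regular_function Z f"
  shows "regular_function U (\<lambda>x. f (g x))"
proof -
  obtain P Q where *: "real_polynomial_function P" "real_polynomial_function Q"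
      "\<forall>z\<in>Z. Q z \<noteq> 0 \<and> f z = P z / Q z"
    using assms(3) unfolding regular_function_def by metis
  have "regular_function U (\<lambda>x. P (g x) / Q (g x))"
    using * assms by (intro regular_function_divide regular_function_compose_polynomial) auto
  then show ?thesis
    by (rule regular_function_cong) (use * assms(2) in auto)
qed

lemma regular_map_compose:
  assumes "regular_map U Z g" "regular_map Z Y f"
  shows "regular_map U Y (\<lambda>x. f (g x))"
proof -
  have "g ` U \<subseteq> Z" "\<forall>b\<in>Basis. regular_function U (\<lambda>x. g x \<bullet> b)"
    using assms(1) unfolding regular_map_def by auto
  then show ?thesis
    using assms(2) regular_function_compose[of U g Z "\<lambda>z. f z \<bullet> b" for b]
    unfolding regular_map_def by auto
qed

lemma regular_map_subset: "regular_map U Z f \<Longrightarrow> V \<subseteq> U \<Longrightarrow> f ` V \<subseteq> Z' \<Longrightarrow> regular_map V Z' f"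
  unfolding regular_map_def by (auto intro: regular_function_subset)

lemma regular_map_polynomial:
  fixes p :: "'a::euclidean_space \<Rightarrow> 'b::euclidean_space"
  shows "polynomial_function p \<Longrightarrow> p ` U \<subseteq> Z \<Longrightarrow> regular_map U Z p"
  unfolding regular_map_def
  by (auto intro!: regular_function_polynomial simp: polynomial_function_iff_Basis_inner)

lemma regular_map_add:
  assumes "regular_map U UNIV f" "regular_map U UNIV g"
  shows "regular_map U UNIV (\<lambda>x. f x + g x)"
  using assms unfolding regular_map_def by (auto simp: inner_add_left intro: regular_function_add)

lemma regular_map_scaleR:
  assumes "regular_function U f" "regular_map U UNIV g"
  shows "regular_map U UNIV (\<lambda>x. f x *\<^sub>R g x)"
  using assms unfolding regular_map_def by (auto intro: regular_function_mult)

lemma regular_map_sum: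
  "(\<And>i. i \<in> I \<Longrightarrow> regular_map U UNIV (f i)) \<Longrightarrow> regular_map U UNIV (\<lambda>x. \<Sum>i\<in>I. f i x)"
  unfolding regular_map_def by (auto simp: inner_sum_left intro!: regular_function_sum)

lemma regular_map_Pair:
  assumes "regular_map U UNIV f" "regular_map U UNIV g"
  shows "regular_map U UNIV (\<lambda>x. (f x, g x))"
  using assms unfolding regular_map_def Basis_prod_def by auto

text \<open>
  The definition gives each coordinate its own denominator. Having one for all coordinates makes
  a regular map a polynomial map divided by a scalar polynomial, which gives continuity, the
  extension to an open set and the clearing of denominators in one stroke.
\<close>

lemma regular_map_fraction:
  fixes f :: "'a::euclidean_space \<Rightarrow> 'b::euclidean_space"
  assumes "regular_map U Z f"
  obtains P Q where "polynomial_function P" "real_polynomial_function Q"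
    "\<And>x. x \<in> U \<Longrightarrow> Q x \<noteq> 0 \<and> f x = (1 / Q x) *\<^sub>R P x"
proof -
  obtain P Q where PQ: "\<And>b. b \<in> Basis \<Longrightarrow> real_polynomial_function (P b) \<and>
      real_polynomial_function (Q b) \<and> (\<forall>x\<in>U. Q b x \<noteq> 0 \<and> f x \<bullet> b = P b x / Q b x)"
    using assms unfolding regular_map_def regular_function_def by metis
  define q where "q x = (\<Prod>b\<in>Basis. Q b x)" for x
  define p where "p x = (\<Sum>b\<in>Basis. (P b x * (\<Prod>c\<in>Basis - {b}. Q c x)) *\<^sub>R b)" for x
  show ?thesis
  proof
    show "polynomial_function p"
      unfolding polynomial_function_iff_Basis_inner p_def using PQ
      by (auto intro!: real_polynomial_function_prod)
    show "real_polynomial_function q"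
      unfolding q_def using PQ by (auto intro!: real_polynomial_function_prod)
    fix x assume x: "x \<in> U"
    have q: "q x \<noteq> 0"
      unfolding q_def using PQ x by auto
    moreover have "f x = (1 / q x) *\<^sub>R p x"
    proof (rule euclidean_eqI)
      fix b :: 'b assume b: "b \<in> Basis"
      have "q x = Q b x * (\<Prod>c\<in>Basis - {b}. Q c x)"
        unfolding q_def by (simp add: prod.remove[OF _ b])
      then show "f x \<bullet> b = (1 / q x) *\<^sub>R p x \<bullet> b"
        using PQ[OF b] x q b by (simp add: p_def field_simps)
    qed
    ultimately show "q x \<noteq> 0 \<and> f x = (1 / q x) *\<^sub>R p x" ..
  qed
qed

lemma regular_map_continuous_on:
  assumes "regular_map U Z f"
  shows "continuous_on U f"
proof -
  obtain P Q where *: "polynomial_function P" "real_polynomial_function Q"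
    "\<And>x. x \<in> U \<Longrightarrow> Q x \<noteq> 0 \<and> f x = (1 / Q x) *\<^sub>R P x"
    using regular_map_fraction[OF assms] by metis
  have "continuous_on U (\<lambda>x. (1 / Q x) *\<^sub>R P x)"
    using *(3)
    by (intro continuous_intros continuous_on_polymonial_function
          *(1) *(2)[unfolded real_polynomial_function_eq]) simp
  then show ?thesis
    by (rule continuous_on_eq) (use * in simp)
qed

text \<open>
  The fraction makes sense wherever its denominator does not vanish. The extension is what can be
  differentiated, \<open>U\<close> itself being in general a thin set.
\<close>

lemma regular_map_extends_to_open:
  fixes f :: "'a::euclidean_space \<Rightarrow> 'b::euclidean_space"
  assumes "regular_map U Z f"
  obtains W g where "open W" "U \<subseteq> W" "regular_map W UNIV g" "g differentiable_on W"
    "\<And>x. x \<in> U \<Longrightarrow> g x = f x"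
proof -
  obtain P Q where *: "polynomial_function P" "real_polynomial_function Q"
    "\<And>x. x \<in> U \<Longrightarrow> Q x \<noteq> 0 \<and> f x = (1 / Q x) *\<^sub>R P x"
    using regular_map_fraction[OF assms] by metis
  define W where "W = {x. Q x \<noteq> 0}"
  have "continuous_on UNIV Q"
    using *(2) by (simp add: continuous_on_polymonial_function real_polynomial_function_eq)
  then have "open W"
    unfolding W_def by (intro open_Collect_neq) auto
  moreover have "regular_map W UNIV (\<lambda>x. (1 / Q x) *\<^sub>R P x)"
    using * unfolding W_def
    by (intro regular_map_scaleR regular_function_divide regular_map_polynomial)
       (auto intro: regular_function_polynomial)
  moreover have "(\<lambda>x. (1 / Q x) *\<^sub>R P x) differentiable_on W"
    unfolding differentiable_on_def W_def
    by (intro ballI differentiable_scaleR differentiable_divide differentiable_const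
          differentiable_at_real_polynomial_function differentiable_at_polynomial_function *) simp
  ultimately show ?thesis
    using that[of W "\<lambda>x. (1 / Q x) *\<^sub>R P x"] * unfolding W_def by auto
qed

lemma regular_map_linear:
  fixes f :: "'a::euclidean_space \<Rightarrow> 'b::euclidean_space" and L :: "'b \<Rightarrow> 'c::euclidean_space"
  assumes "regular_map U UNIV f" "bounded_linear L"
  shows "regular_map U UNIV (\<lambda>x. L (f x))"
  by (rule regular_map_compose[OF assms(1)])
     (auto intro!: regular_map_polynomial polynomial_function_bounded_linear assms(2))

lemma regular_map_diff:
  fixes f g :: "'a::euclidean_space \<Rightarrow> 'b::euclidean_space"
  assumes "regular_map U UNIV f" "regular_map U UNIV g"
  shows "regular_map U UNIV (\<lambda>x. f x - g x)"
  using regular_map_add[OF assms(1) regular_map_linear[OF assms(2) bounded_linear_minus[OF bounded_linear_ident]]]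
  by simp

section \<open>Increments\<close>

text \<open>
  The multivariate counterpart of the divisibility of \<open>p y - p x\<close> by \<open>y - x\<close>. The point is the joint
  continuity of the coefficient \<open>H\<close>: it turns every estimate that is uniform in \<open>x\<close> and \<open>y\<close> (strict
  differentiability, mean value inequalities) into the continuity of a function of two points.
\<close>

lemma polynomial_increment:
  fixes p :: "'a::euclidean_space \<Rightarrow> real"
  assumes "real_polynomial_function p"
  obtains H where "continuous_on UNIV (\<lambda>(x, y). H x y)" "\<And>x y. p y - p x = H x y \<bullet> (y - x)"
proof -
  have cont: "continuous_on UNIV f" if "real_polynomial_function f" for f :: "'a \<Rightarrow> real"
    using that by (simp add: continuous_on_polymonial_function real_polynomial_function_eq)
  have "\<exists>H. continuous_on UNIV (\<lambda>(x, y). H x y) \<and> (\<forall>x y. p y - p x = H x y \<bullet> (y - x))"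
    using assms
  proof induction
    case (linear f)
    interpret bounded_linear f by fact
    have "f y - f x = (\<Sum>b\<in>Basis. f b *\<^sub>R b) \<bullet> (y - x)" for x y
    proof -
      have "f y - f x = f (\<Sum>b\<in>Basis. ((y - x) \<bullet> b) *\<^sub>R b)"
        by (simp add: euclidean_representation diff)
      then show ?thesis
        by (simp add: sum scaleR inner_sum_left inner_commute[of "y - x"] mult.commute)
    qed
    then show ?case
      by (intro exI[of _ "\<lambda>x y. \<Sum>b\<in>Basis. f b *\<^sub>R b"]) auto
  next
    case (const c)
    then show ?case by (intro exI[of _ "\<lambda>x y. 0"]) auto
  next
    case (add f g)
    then obtain F G where F: "continuous_on UNIV (\<lambda>(x, y). F x y)" "\<And>x y. f y - f x = F x y \<bullet> (y - x)"
      and G: "continuous_on UNIV (\<lambda>(x, y). G x y)" "\<And>x y. g y - g x = G x y \<bullet> (y - x)" by blast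
    have "continuous_on UNIV (\<lambda>(x, y). F x y + G x y)"
      using F(1) G(1) by (auto simp: case_prod_unfold intro!: continuous_intros)
    moreover have "f y + g y - (f x + g x) = (F x y + G x y) \<bullet> (y - x)" for x y
      by (simp add: inner_add_left F(2)[symmetric] G(2)[symmetric])
    ultimately show ?case
      by (intro exI[of _ "\<lambda>x y. F x y + G x y"]) auto
  next
    case (mult f g)
    then obtain F G where F: "continuous_on UNIV (\<lambda>(x, y). F x y)" "\<And>x y. f y - f x = F x y \<bullet> (y - x)"
      and G: "continuous_on UNIV (\<lambda>(x, y). G x y)" "\<And>x y. g y - g x = G x y \<bullet> (y - x)" by blast
    have "continuous_on UNIV (\<lambda>(x, y). g y *\<^sub>R F x y + f x *\<^sub>R G x y)"
      using F(1) G(1) mult(1,2)[THEN cont]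
      by (auto simp: case_prod_unfold
               intro!: continuous_intros elim!: continuous_on_compose2)
    moreover have "f y * g y - f x * g x = (g y *\<^sub>R F x y + f x *\<^sub>R G x y) \<bullet> (y - x)" for x y
    proof -
      have "f y * g y - f x * g x = g y * (f y - f x) + f x * (g y - g x)"
        by (simp add: algebra_simps)
      then show ?thesis by (simp add: inner_add_left F(2) G(2))
    qed
    ultimately show ?case
      by (intro exI[of _ "\<lambda>x y. g y *\<^sub>R F x y + f x *\<^sub>R G x y"]) auto
  qed
  then show ?thesis using that by metis
qed

lemma regular_function_increment:
  fixes f :: "'a::euclidean_space \<Rightarrow> real"
  assumes "regular_function U f"
  obtains H where "continuous_on (U \<times> U) (\<lambda>(x, y). H x y)"
    "\<And>x y. x \<in> U \<Longrightarrow> y \<in> U \<Longrightarrow> f y - f x = H x y \<bullet> (y - x)"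
proof -
  obtain P Q where PQ: "real_polynomial_function P" "real_polynomial_function Q"
      "\<And>x. x \<in> U \<Longrightarrow> Q x \<noteq> 0 \<and> f x = P x / Q x"
    using assms unfolding regular_function_def by metis
  have cont: "continuous_on UNIV P" "continuous_on UNIV Q"
    using PQ by (simp_all add: continuous_on_polymonial_function real_polynomial_function_eq)
  obtain F where F: "continuous_on UNIV (\<lambda>(x, y). F x y)" "\<And>x y. P y - P x = F x y \<bullet> (y - x)"
    using polynomial_increment[OF PQ(1)] by metis
  obtain G where G: "continuous_on UNIV (\<lambda>(x, y). G x y)" "\<And>x y. Q y - Q x = G x y \<bullet> (y - x)"
    using polynomial_increment[OF PQ(2)] by metis
  define H where "H x y = (1 / (Q x * Q y)) *\<^sub>R (Q x *\<^sub>R F x y - P x *\<^sub>R G x y)" for x y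
  show ?thesis
  proof
    have "continuous_on (U \<times> U) (\<lambda>z. F (fst z) (snd z))" "continuous_on (U \<times> U) (\<lambda>z. G (fst z) (snd z))"
      using F(1) G(1) by (auto simp: case_prod_unfold intro: continuous_on_subset)
    moreover have "continuous_on (U \<times> U) (\<lambda>z. P (fst z))" "continuous_on (U \<times> U) (\<lambda>z. Q (fst z))"
        "continuous_on (U \<times> U) (\<lambda>z. Q (snd z))"
      by (auto intro!: continuous_on_compose2[OF cont(1)] continuous_on_compose2[OF cont(2)]
            continuous_intros)
    ultimately show "continuous_on (U \<times> U) (\<lambda>(x, y). H x y)"
      unfolding H_def case_prod_unfold using PQ(3) by (auto intro!: continuous_intros)
    fix x y assume "x \<in> U" "y \<in> U"
    then show "f y - f x = H x y \<bullet> (y - x)"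
      using PQ(3)
      by (simp add: H_def inner_diff_left F(2)[symmetric] G(2)[symmetric] field_simps)
  qed
qed

text \<open>
  For each pair of points a linear map taking their difference to the difference of the values of \<open>f\<close>.
  On the diagonal it plays the role of the derivative. Only points of \<open>S\<close> are involved, so \<open>f\<close> need not be
  extended to a neighbourhood of \<open>S\<close>, and segments between points of \<open>S\<close> may leave \<open>S\<close>.
\<close>

definition increment_matrix ::
    "'a::euclidean_space set \<Rightarrow> ('a \<Rightarrow> 'b::euclidean_space) \<Rightarrow> ('a \<Rightarrow> 'a \<Rightarrow> 'a \<Rightarrow> 'b) \<Rightarrow> bool" where
  "increment_matrix S f M \<longleftrightarrow>
     (\<forall>p q. linear (M p q)) \<and>
     (\<forall>v. continuous_on (S \<times> S) (\<lambda>(p, q). M p q v)) \<and>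
     (\<forall>p\<in>S. \<forall>q\<in>S. f q - f p = M p q (q - p))"

lemma regular_map_increment:
  fixes f :: "'a::euclidean_space \<Rightarrow> 'b::euclidean_space"
  assumes "regular_map S Z f"
  obtains M where "increment_matrix S f M"
proof -
  have "\<forall>b\<in>Basis. \<exists>H. continuous_on (S \<times> S) (\<lambda>(x, y). H x y) \<and>
      (\<forall>x\<in>S. \<forall>y\<in>S. f y \<bullet> b - f x \<bullet> b = H x y \<bullet> (y - x))"
  proof
    fix b :: 'b assume "b \<in> Basis"
    then have "regular_function S (\<lambda>x. f x \<bullet> b)"
      using assms unfolding regular_map_def by blast
    then obtain H where "continuous_on (S \<times> S) (\<lambda>(x, y). H x y)"
      "\<And>x y. x \<in> S \<Longrightarrow> y \<in> S \<Longrightarrow> f y \<bullet> b - f x \<bullet> b = H x y \<bullet> (y - x)"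
      by (rule regular_function_increment) simp
    then show "\<exists>H. continuous_on (S \<times> S) (\<lambda>(x, y). H x y) \<and>
      (\<forall>x\<in>S. \<forall>y\<in>S. f y \<bullet> b - f x \<bullet> b = H x y \<bullet> (y - x))"
      by (intro exI[of _ H]) simp
  qed
  then obtain H where H: "\<And>b. b \<in> Basis \<Longrightarrow> continuous_on (S \<times> S) (\<lambda>(x, y). H b x y)"
    "\<And>b x y. b \<in> Basis \<Longrightarrow> x \<in> S \<Longrightarrow> y \<in> S \<Longrightarrow> f y \<bullet> b - f x \<bullet> b = H b x y \<bullet> (y - x)"
    by metis
  have "increment_matrix S f (\<lambda>p q v. \<Sum>b\<in>Basis. (H b p q \<bullet> v) *\<^sub>R b)"
    unfolding increment_matrix_def
  proof (intro conjI allI ballI)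
    show "linear (\<lambda>v. \<Sum>b\<in>Basis. (H b p q \<bullet> v) *\<^sub>R b)" for p q
      by (intro linear_compose_sum ballI linearI) (simp_all add: inner_add_right scaleR_left_distrib)
    show "continuous_on (S \<times> S) (\<lambda>(p, q). \<Sum>b\<in>Basis. (H b p q \<bullet> v) *\<^sub>R b)" for v
      using H(1) unfolding case_prod_unfold by (auto intro!: continuous_intros)
    show "f q - f p = (\<Sum>b\<in>Basis. (H b p q \<bullet> (q - p)) *\<^sub>R b)" if "p \<in> S" "q \<in> S" for p q
      by (rule euclidean_eqI) (use H(2) that in \<open>simp add: inner_diff_left\<close>)
  qed
  then show ?thesis by (rule that)
qed

lemma increment_matrix_continuous:
  fixes M :: "'a::euclidean_space \<Rightarrow> 'a \<Rightarrow> 'a \<Rightarrow> 'b::euclidean_space"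
  assumes "increment_matrix S f M" "continuous_on A p" "continuous_on A q" "continuous_on A v"
    "p ` A \<subseteq> S" "q ` A \<subseteq> S"
  shows "continuous_on A (\<lambda>x. M (p x) (q x) (v x))"
proof -
  have "M (p x) (q x) (v x) = (\<Sum>b\<in>Basis. (v x \<bullet> b) *\<^sub>R M (p x) (q x) b)" for x
  proof -
    interpret linear "M (p x) (q x)" using assms(1) unfolding increment_matrix_def by blast
    have "M (p x) (q x) (v x) = M (p x) (q x) (\<Sum>b\<in>Basis. (v x \<bullet> b) *\<^sub>R b)"
      by (simp add: euclidean_representation)
    then show ?thesis by (simp add: sum scaleR)
  qed
  moreover have "continuous_on A (\<lambda>x. M (p x) (q x) b)" for b
  proof -
    have "continuous_on (S \<times> S) (\<lambda>z. M (fst z) (snd z) b)"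
      using assms(1) unfolding increment_matrix_def case_prod_unfold by blast
    from continuous_on_compose2[OF this, of A "\<lambda>x. (p x, q x)"] show ?thesis
      using assms by (auto intro!: continuous_intros)
  qed
  ultimately show ?thesis
    using assms by (auto intro!: continuous_intros)
qed

text \<open>
  In general \<open>M p p\<close> is not determined by \<open>f\<close>, but it is in the directions of lines through \<open>p\<close> contained in \<open>S\<close>;
  for a vector bundle these include the directions of the fibre.
\<close>

lemma increment_matrix_line_derivative:
  fixes f :: "'a::euclidean_space \<Rightarrow> 'b::euclidean_space"
  assumes "increment_matrix S f M" "\<And>t. p + t *\<^sub>R v \<in> S"
  shows "((\<lambda>t. f (p + t *\<^sub>R v)) has_vector_derivative M p p v) (at 0)"
proof -
  have p: "p \<in> S" using assms(2)[of 0] by simp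
  have lin: "linear (M p q)" for p q using assms(1) unfolding increment_matrix_def by blast
  have "continuous_on UNIV (\<lambda>t. M p (p + t *\<^sub>R v) v)"
    by (rule increment_matrix_continuous[OF assms(1)]) (use assms(2) p in \<open>auto intro!: continuous_intros\<close>)
  then have "((\<lambda>t. M p (p + t *\<^sub>R v) v) \<longlongrightarrow> M p (p + 0 *\<^sub>R v) v) (at 0)"
    unfolding continuous_on_def by blast
  then have "((\<lambda>t. norm (M p (p + t *\<^sub>R v) v - M p p v)) \<longlongrightarrow> 0) (at 0)"
    by (simp add: tendsto_norm_zero_iff LIM_zero)
  \<comment> \<open>For \<open>t = 0\<close> both sides vanish, the left one because division by zero gives zero.\<close>
  moreover have "norm (f (p + t *\<^sub>R v) - f p - t *\<^sub>R M p p v) / norm t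
      = norm (M p (p + t *\<^sub>R v) v - M p p v)" for t
  proof -
    have "f (p + t *\<^sub>R v) - f p = t *\<^sub>R M p (p + t *\<^sub>R v) v"
      using assms p linear_scale[OF lin, of p "p + t *\<^sub>R v" t v]
      unfolding increment_matrix_def by simp
    then show ?thesis
      by (simp flip: scaleR_diff_right)
  qed
  ultimately show ?thesis
    by (simp add: has_vector_derivative_def has_derivative_at bounded_linear_scaleR_left)
qed


section \<open>Tangent vectors and domination\<close>

text \<open>
  The tangent space is defined by polynomials, and this extends the defining property to regular maps. If
  \<open>f = P / Q\<close> vanishes on \<open>M\<close>, so does \<open>P\<close>, hence \<open>P' e = 0\<close>; and \<open>P' e = Q a \<cdot> f' e\<close> as \<open>f a = 0\<close>.
  Identities between regular maps on \<open>M\<close> can thus be differentiated along tangent vectors of \<open>M\<close>.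
\<close>

lemma derivative_vanishes_on_tangent_space:
  fixes f :: "'a::euclidean_space \<Rightarrow> 'b::euclidean_space"
  assumes "open W" "M \<subseteq> W" "regular_map W UNIV f" "\<And>x. x \<in> M \<Longrightarrow> f x = 0"
    and "a \<in> M" "e \<in> tangent_space M a" "(f has_derivative f') (at a)"
  shows "f' e = 0"
proof -
  obtain P Q where PQ: "polynomial_function P" "real_polynomial_function Q"
      "\<And>x. x \<in> W \<Longrightarrow> Q x \<noteq> 0 \<and> f x = (1 / Q x) *\<^sub>R P x"
    using regular_map_fraction[OF assms(3)] by metis
  obtain P' where P': "(P has_derivative P') (at a)"
    using differentiable_at_polynomial_function[OF PQ(1)] unfolding differentiable_def by blast
  obtain Q' where Q': "(Q has_derivative Q') (at a)"
    using differentiable_at_real_polynomial_function[OF PQ(2)] unfolding differentiable_def by blast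
  have "P' e = 0"
  proof (rule euclidean_eqI)
    fix b :: 'b assume b: "b \<in> Basis"
    have "P x \<bullet> b = 0" if "x \<in> M" for x
    proof -
      have "x \<in> W" using that assms(2) by blast
      then show ?thesis using PQ(3)[of x] assms(4)[OF that] by auto
    qed
    then have "frechet_derivative (\<lambda>x. P x \<bullet> b) (at a) e = 0"
      using assms(6) PQ(1) b unfolding tangent_space_def polynomial_function_iff_Basis_inner by blast
    moreover have "((\<lambda>x. P x \<bullet> b) has_derivative (\<lambda>h. P' h \<bullet> b)) (at a)"
      by (intro derivative_intros P')
    ultimately show "P' e \<bullet> b = 0 \<bullet> b"
      by (metis frechet_derivative_at inner_zero_left)
  qed
  moreover have "((\<lambda>x. Q x *\<^sub>R f x) has_derivative (\<lambda>h. Q a *\<^sub>R f' h + Q' h *\<^sub>R f a)) (at a)"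
    by (intro has_derivative_scaleR Q' assms(7))
  then have "(P has_derivative (\<lambda>h. Q a *\<^sub>R f' h + Q' h *\<^sub>R f a)) (at a)"
    by (rule has_derivative_transform_within_open[of _ _ _ _ W]) (use PQ(3) assms in auto)
  then have "P' e = Q a *\<^sub>R f' e + Q' e *\<^sub>R f a"
    using has_derivative_unique[OF P'] by metis
  ultimately show ?thesis
    using PQ(3)[of a] assms(2,4,5) by auto
qed

lemma smooth_map_continuous_on:
  assumes "smooth_map V E f"
  shows "continuous_on V f"
  unfolding continuous_on_eq_continuous_within
proof
  fix x assume x: "x \<in> V"
  then obtain U F where U: "open U" "x \<in> U" "\<forall>k. Ck_on k U F" "\<forall>z\<in>U \<inter> V. F z = f z"
    using assms unfolding smooth_map_def by meson
  have "continuous_on U F"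
    using U(3)[rule_format, of 0] by simp
  then have "continuous_on (U \<inter> V) F"
    by (rule continuous_on_subset) simp
  then have "continuous_on (U \<inter> V) f"
    by (rule continuous_on_eq) (use U in auto)
  then have "continuous (at x within (U \<inter> V)) f"
    using x U by (simp add: continuous_on_eq_continuous_within)
  moreover have "at x within (U \<inter> V) = at x within V"
    by (rule at_within_nhd[of x U]) (use U in auto)
  ultimately show "continuous (at x within V) f" by simp
qed

lemma product_sub_sel [simp]:
  "total_space (product_sub S) = S" "proj (product_sub S) u = fst u"
  "vadd (product_sub S) u v = (fst u, snd u + snd v)"
  "vscale (product_sub S) a u = (fst u, a *\<^sub>R snd u)"
  by (simp_all add: product_sub_def)

lemma fibre_vector_space:
  assumes "vector_space_fibres Y E" "y \<in> Y"
  shows "zero_vec E y \<in> fibre E y"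
    and "u \<in> fibre E y \<Longrightarrow> v \<in> fibre E y \<Longrightarrow> vadd E u v \<in> fibre E y"
    and "u \<in> fibre E y \<Longrightarrow> vadd E (zero_vec E y) u = u"
  using assms unfolding vector_space_fibres_def Let_def by blast+

text \<open>
  With \<open>\<phi> : E \<rightarrow> S\<close> the isomorphism and \<open>\<psi>\<close> its inverse, take \<open>T = s\<^sub>V \<circ> \<psi>\<close> and \<open>(y, \<omega> y) = \<phi> (\<tau>\<^sub>V y)\<close>.
  Since \<open>\<phi>\<close> is fibrewise additive, \<open>s\<^sub>V (\<psi> (y, w) + \<tau>\<^sub>V y) = T (y, w + \<omega> y)\<close>. What needs an argument is that
  the tangent vectors occurring in the domination, which are those of \<open>fibre E y\<close> as a subset of its
  ambient space, are the velocities of the curves \<open>t \<mapsto> \<psi> (y, t w)\<close> with \<open>w\<close> in the fibre of \<open>S\<close>.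
\<close>

lemma dominating_quasi_spray_on_subbundle:
  fixes Y :: "'y::euclidean_space set"
  assumes "quasi_malleable TYPE('e::euclidean_space) TYPE('k::euclidean_space) Y"
    and V: "V \<in> rel_compact_opens Y"
  obtains S :: "('y \<times> 'k::euclidean_space) set" and T \<omega>
  where "algebraic_subbundle Y S" "regular_map S Y T" "continuous_on V \<omega>"
    "\<And>y. y \<in> V \<Longrightarrow> (y, \<omega> y) \<in> S \<and> T (y, \<omega> y) = y"
    "\<And>y u. y \<in> V \<Longrightarrow> u \<in> tangent_space Y y \<Longrightarrow>
       \<exists>w. (y, w) \<in> S \<and> ((\<lambda>t. T (y, \<omega> y + t *\<^sub>R w)) has_vector_derivative u) (at 0)"
proof -
  obtain E :: "('e, 'y) vbundle" and s \<tau>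
    where "quasi_spray TYPE('k) Y E s \<tau>" and dom: "dominating Y E s \<tau>"
    using assms(1) unfolding quasi_malleable_def by blast
  then have avb: "algebraic_vector_bundle TYPE('k) Y E"
    and s: "regular_map (total_space E) Y (s V)"
    and \<tau>: "smooth_map V (total_space E) (\<tau> V)"
    and s\<tau>: "\<And>y. y \<in> V \<Longrightarrow> s V (\<tau> V y) = y" "\<And>y. y \<in> V \<Longrightarrow> proj E (\<tau> V y) = y"
    using V unfolding quasi_spray_def by blast+
  have fibres: "vector_space_fibres Y E"
    using avb unfolding algebraic_vector_bundle_def by blast
  obtain S :: "('y \<times> 'k) set" where S: "algebraic_subbundle Y S" and "vb_isomorphic E (product_sub S)"
    using avb unfolding algebraic_vector_bundle_def by blast
  then obtain \<phi> \<psi> where \<phi>: "regular_map (total_space E) S \<phi>" and \<psi>: "regular_map S (total_space E) \<psi>"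
    and \<psi>\<phi>: "\<And>u. u \<in> total_space E \<Longrightarrow> \<psi> (\<phi> u) = u" and \<phi>\<psi>: "\<And>p. p \<in> S \<Longrightarrow> \<phi> (\<psi> p) = p"
    and proj: "\<And>u. u \<in> total_space E \<Longrightarrow> fst (\<phi> u) = proj E u"
    and add: "\<And>u v. u \<in> total_space E \<Longrightarrow> v \<in> total_space E \<Longrightarrow> proj E u = proj E v \<Longrightarrow>
      \<phi> (vadd E u v) = (fst (\<phi> u), snd (\<phi> u) + snd (\<phi> v))"
    unfolding vb_isomorphic_def product_sub_sel by blast
  have \<phi>_in: "\<phi> u \<in> S" if "u \<in> total_space E" for u
    using \<phi> that unfolding regular_map_def by blast
  have \<psi>_in: "\<psi> p \<in> total_space E" if "p \<in> S" for p
    using \<psi> that unfolding regular_map_def by blast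
  have VY: "V \<subseteq> Y"
    using V unfolding rel_compact_opens_def by (auto dest: openin_imp_subset)
  have \<tau>_in: "\<tau> V y \<in> fibre E y" if "y \<in> V" for y
    using \<tau> s\<tau>(2) that unfolding smooth_map_def fibre_def by blast
  define T where "T p = s V (\<psi> p)" for p
  define \<omega> where "\<omega> y = snd (\<phi> (\<tau> V y))" for y
  have \<phi>\<tau>: "\<phi> (\<tau> V y) = (y, \<omega> y)" if "y \<in> V" for y
    using \<tau>_in[OF that] proj unfolding \<omega>_def fibre_def by (auto simp: prod_eq_iff)
  show ?thesis
  proof
    show "algebraic_subbundle Y S" by fact
    show "regular_map S Y T"
      unfolding T_def by (rule regular_map_compose[OF \<psi> s])
    have "continuous_on V (\<lambda>y. \<phi> (\<tau> V y))"
      by (rule continuous_on_compose2[OF regular_map_continuous_on[OF \<phi>] smooth_map_continuous_on[OF \<tau>]])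
         (use \<tau> in \<open>auto simp: smooth_map_def\<close>)
    then show "continuous_on V \<omega>"
      unfolding \<omega>_def by (rule continuous_on_snd)
    show "(y, \<omega> y) \<in> S \<and> T (y, \<omega> y) = y" if "y \<in> V" for y
    proof -
      have "\<tau> V y \<in> total_space E" using \<tau>_in[OF that] unfolding fibre_def by blast
      then show ?thesis
        using \<phi>_in \<psi>\<phi> s\<tau>(1)[OF that] \<phi>\<tau>[OF that] unfolding T_def by metis
    qed
    fix y u assume y: "y \<in> V" and u: "u \<in> tangent_space Y y"
    define F where "F = fibre E y"
    define z where "z = zero_vec E y"
    define h where "h v = s V (vadd E v (\<tau> V y))" for v
    have yY: "y \<in> Y" using y VY by blast
    have F: "F \<subseteq> total_space E" "\<And>v. v \<in> F \<Longrightarrow> fst (\<phi> v) = y"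
      using proj unfolding F_def fibre_def by auto
    note fib = fibre_vector_space[OF fibres yY, folded F_def z_def]
    have "submersion_at F Y h z"
      using dom V y unfolding dominating_def F_def z_def h_def by blast
    then obtain h' where h': "(h has_derivative h') (at z within F)"
      "h' ` tangent_space F z = tangent_space Y (h z)"
      unfolding submersion_at_def by blast
    have "h z = y"
      using fib(3) \<tau>_in[OF y] s\<tau>(1)[OF y] unfolding h_def F_def by simp
    with h'(2) u have "u \<in> h' ` tangent_space F z" by simp
    then obtain e where e: "e \<in> tangent_space F z" "h' e = u" by auto
    have zE: "z \<in> total_space E" using fib(1) F(1) by blast
    have "\<phi> z = \<phi> (vadd E z z)" using fib(1,3) by simp
    also have "\<dots> = (fst (\<phi> z), snd (\<phi> z) + snd (\<phi> z))" using add zE by blast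
    finally have \<phi>z: "\<phi> z = (y, 0)"
      using F(2)[OF fib(1)] by (simp add: prod_eq_iff)
    obtain W1 f where W1: "open W1" "total_space E \<subseteq> W1" "regular_map W1 UNIV f"
      "f differentiable_on W1" "\<And>x. x \<in> total_space E \<Longrightarrow> f x = \<phi> x"
      by (rule regular_map_extends_to_open[OF \<phi>]) (rule that)
    obtain W2 g where W2: "open W2" "S \<subseteq> W2" "regular_map W2 UNIV g"
      "g differentiable_on W2" "\<And>p. p \<in> S \<Longrightarrow> g p = \<psi> p"
      by (rule regular_map_extends_to_open[OF \<psi>]) (rule that)
    have fz: "f z = (y, 0)" using W1(5)[OF zE] \<phi>z by simp
    have zS: "(y, 0) \<in> S" using \<phi>_in[OF zE] \<phi>z by simp
    have "f differentiable (at z)"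
      using W1(1,2,4) zE differentiable_on_eq_differentiable_at by blast
    then obtain f' where f': "(f has_derivative f') (at z)"
      unfolding differentiable_def by blast
    have "g differentiable (at (y, 0))"
      using W2(1,2,4) zS differentiable_on_eq_differentiable_at by blast
    then obtain g' where g': "(g has_derivative g') (at (y, 0))"
      unfolding differentiable_def by blast
    have FW1: "F \<subseteq> W1" using F(1) W1(2) by blast
    have fF: "f x = \<phi> x" if "x \<in> F" for x
      using W1(5) F(1) that by blast
    \<comment> \<open>Differentiating along \<open>e\<close> the relations that hold on the fibre \<open>F\<close>: \<open>\<phi>\<close> maps \<open>F\<close> to \<open>{y} \<times> S\<^sub>y\<close>,
      so \<open>f' e = (0, w)\<close> with \<open>w \<in> S\<^sub>y\<close>, and \<open>\<psi> \<circ> \<phi>\<close> is the identity on \<open>F\<close>, so \<open>g' (0, w) = e\<close>.\<close>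
    define w where "w = snd (f' e)"
    have "fst (f' e) = 0"
    proof (rule derivative_vanishes_on_tangent_space[OF W1(1) FW1, where f = "\<lambda>x. fst (f x) - y"])
      show "regular_map W1 UNIV (\<lambda>x. fst (f x) - y)"
        by (intro regular_map_diff regular_map_linear[OF W1(3) bounded_linear_fst])
           (auto intro!: regular_map_polynomial)
      show "((\<lambda>x. fst (f x) - y) has_derivative (\<lambda>h. fst (f' h))) (at z)"
        using f' by (auto intro!: derivative_eq_intros)
    qed (use fib(1) e(1) F(2) fF in auto)
    then have f'e: "f' e = (0, w)" unfolding w_def by (metis prod.collapse)
    have wS: "(y, w) \<in> S"
    proof -
      have sub: "subspace {v. (y, v) \<in> S}"
        using S yY unfolding algebraic_subbundle_def by blast
      obtain p n where p: "p \<in> span {v. (y, v) \<in> S}"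
        and n: "\<And>v. v \<in> span {v. (y, v) \<in> S} \<Longrightarrow> orthogonal n v" and w: "w = p + n"
        using orthogonal_subspace_decomp_exists[of "{v. (y, v) \<in> S}" w] by metis
      have "n \<bullet> snd (f' e) = 0"
      proof (rule derivative_vanishes_on_tangent_space[OF W1(1) FW1, where f = "\<lambda>x. n \<bullet> snd (f x)"])
        show "regular_map W1 UNIV (\<lambda>x. n \<bullet> snd (f x))"
          by (rule regular_map_linear[OF W1(3)])
             (intro bounded_linear_inner_right_comp bounded_linear_snd)
        show "((\<lambda>x. n \<bullet> snd (f x)) has_derivative (\<lambda>h. n \<bullet> snd (f' h))) (at z)"
          using f' by (auto intro!: derivative_eq_intros)
        show "n \<bullet> snd (f x) = 0" if "x \<in> F" for x
        proof -
          have "(y, snd (\<phi> x)) \<in> S"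
            using \<phi>_in[of x] F that by (metis prod.collapse subsetD)
          then show ?thesis
            using n[of "snd (\<phi> x)"] fF[OF that] by (simp add: span_base orthogonal_def)
        qed
      qed (use fib(1) e(1) in auto)
      then have "n \<bullet> n = 0"
        using n[OF p] w unfolding w_def[symmetric] by (simp add: inner_add_right orthogonal_def)
      then show ?thesis
        using p w sub by (auto simp: span_eq_iff[THEN iffD2])
    qed
    have line: "(y, t *\<^sub>R w) \<in> S" for t
      using S yY wS unfolding algebraic_subbundle_def by (auto dest: subspace_scale)
    let ?W = "W1 \<inter> f -` W2"
    have "g' (f' e) - e = 0"
    proof (rule derivative_vanishes_on_tangent_space[where f = "\<lambda>x. g (f x) - x"
          and f' = "\<lambda>h. g' (f' h) - h" and e = e and M = F and a = z and W = ?W])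
      show "open ?W"
        by (rule continuous_open_preimage[OF regular_map_continuous_on[OF W1(3)] W1(1) W2(1)])
      show "F \<subseteq> ?W"
      proof
        fix x assume "x \<in> F"
        then show "x \<in> ?W" using FW1 fF \<phi>_in F(1) W2(2) by (metis IntI subsetD vimageI)
      qed
      have "regular_map ?W UNIV (\<lambda>x. g (f x))"
        by (rule regular_map_compose[OF regular_map_subset[OF W1(3)] W2(3)]) auto
      then show "regular_map ?W UNIV (\<lambda>x. g (f x) - x)"
        by (rule regular_map_diff) (auto intro!: regular_map_polynomial)
      have "((\<lambda>x. g (f x)) has_derivative (\<lambda>h. g' (f' h))) (at z)"
        by (rule has_derivative_compose[OF f']) (use g' fz in simp)
      then show "((\<lambda>x. g (f x) - x) has_derivative (\<lambda>h. g' (f' h) - h)) (at z)"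
        by (rule has_derivative_diff) (rule has_derivative_ident)
      show "g (f x) - x = 0" if "x \<in> F" for x
        using W2(5) \<phi>_in F(1) fF \<psi>\<phi> that by (metis right_minus_eq subsetD)
    qed (use fib(1) e(1) in auto)
    then have g'w: "g' (0, w) = e" using f'e by simp
    \<comment> \<open>A curve in \<open>F\<close> through the zero vector with velocity \<open>e\<close>.\<close>
    define c where "c t = \<psi> (y, t *\<^sub>R w)" for t
    have "((\<lambda>t. g ((y, 0) + t *\<^sub>R (0, w))) has_vector_derivative g' (0, w)) (at 0)"
    proof -
      have "((\<lambda>t. (y, 0) + t *\<^sub>R (0, w)) has_vector_derivative (0, w)) (at (0::real))"
        by (auto intro!: derivative_eq_intros)
      from vector_derivative_diff_chain_within[OF this, of g g'] show ?thesis
        using g' by (auto simp: o_def intro: has_derivative_at_withinI)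
    qed
    moreover have "g ((y, 0) + t *\<^sub>R (0, w)) = c t" for t
      unfolding c_def using W2(5)[OF line] by simp
    ultimately have c': "(c has_vector_derivative e) (at 0)"
      using g'w by simp
    have c0: "c 0 = z"
      using \<psi>\<phi>[OF zE] \<phi>z unfolding c_def by simp
    have \<phi>c: "\<phi> (c t) = (y, t *\<^sub>R w)" for t
      unfolding c_def using \<phi>\<psi>[OF line] .
    have cE: "c t \<in> total_space E" for t
      unfolding c_def using \<psi>_in[OF line] .
    have cF: "c t \<in> F" for t
      using proj[OF cE] \<phi>c cE unfolding F_def fibre_def by simp
    have "((h \<circ> c) has_vector_derivative h' e) (at 0)"
      by (rule vector_derivative_diff_chain_within[OF c'])
         (use has_derivative_subset[OF h'(1), of "range c"] cF c0 in auto)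
    moreover have "h (c t) = T (y, \<omega> y + t *\<^sub>R w)" for t
    proof -
      let ?q = "vadd E (c t) (\<tau> V y)"
      have "?q \<in> F" using fib(2)[OF cF] \<tau>_in[OF y] F_def by simp
      then have q: "?q \<in> total_space E" using F(1) by blast
      have "\<phi> ?q = (y, t *\<^sub>R w + \<omega> y)"
        using add[OF cE, of "\<tau> V y" t] \<phi>c \<phi>\<tau>[OF y] cF \<tau>_in[OF y] unfolding F_def fibre_def by simp
      then show ?thesis
        using \<psi>\<phi>[OF q] unfolding h_def T_def by (simp add: add.commute)
    qed
    ultimately have "((\<lambda>t. T (y, \<omega> y + t *\<^sub>R w)) has_vector_derivative u) (at 0)"
      using e(2) by (simp add: o_def)
    with wS show "\<exists>w. (y, w) \<in> S \<and> ((\<lambda>t. T (y, \<omega> y + t *\<^sub>R w)) has_vector_derivative u) (at 0)"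
      by blast
  qed
qed

section \<open>Polynomial sections of algebraic subbundles\<close>

text \<open>
  A local trivialization provides a regular section through the given point over a Zariski open set \<open>U = Y - A\<close>.
  Multiplying it by its denominator and by a polynomial \<open>R\<close> that vanishes on \<open>A\<close> makes it polynomial and
  lets it be continued by zero to all of \<open>Y\<close>; it stays in \<open>S\<close> as the fibres are subspaces. A constant factor
  restores the value at \<open>y\<^sub>0\<close>.
\<close>

lemma algebraic_subbundle_polynomial_section:
  fixes Y :: "'y::euclidean_space set" and S :: "('y \<times> 'k::euclidean_space) set"
  assumes S: "algebraic_subbundle Y S" and yw: "(y\<^sub>0, w) \<in> S"
  obtains \<sigma> where "polynomial_function \<sigma>" "\<And>y. y \<in> Y \<Longrightarrow> (y, \<sigma> y) \<in> S" "\<sigma> y\<^sub>0 = w"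
proof -
  have y0: "y\<^sub>0 \<in> Y" using assms unfolding algebraic_subbundle_def by blast
  then obtain U and W :: "'k set" where U: "zariski_open_in Y U" "y\<^sub>0 \<in> U" "subspace W"
    and iso: "vb_isomorphic (product_sub (S \<inter> (U \<times> UNIV))) (product_sub (U \<times> W))"
    using S unfolding algebraic_subbundle_def by metis
  obtain A where A: "algebraic_set A" "U = Y - A"
    using U(1) unfolding zariski_open_in_def by blast
  obtain R where R: "real_polynomial_function R" "\<And>y. y \<in> A \<Longrightarrow> R y = 0" "R y\<^sub>0 \<noteq> 0"
    using A U(2) unfolding algebraic_set_def by blast
  obtain \<alpha> \<beta> where \<alpha>: "regular_map (S \<inter> (U \<times> UNIV)) (U \<times> W) \<alpha>"
    and \<beta>: "regular_map (U \<times> W) (S \<inter> (U \<times> UNIV)) \<beta>"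
    and "\<forall>u\<in>S \<inter> (U \<times> UNIV). \<beta> (\<alpha> u) = u" "\<forall>u\<in>U \<times> W. \<alpha> (\<beta> u) = u"
    and "\<forall>u\<in>S \<inter> (U \<times> UNIV). fst (\<alpha> u) = fst u"
    using iso unfolding vb_isomorphic_def product_sub_sel by (elim exE conjE) (rule that; assumption)
  note \<beta>\<alpha> = this(3)[rule_format] and \<alpha>\<beta> = this(4)[rule_format] and fst = this(5)[rule_format]
  have yw': "(y\<^sub>0, w) \<in> S \<inter> (U \<times> UNIV)" using yw U by simp
  define v where "v = snd (\<alpha> (y\<^sub>0, w))"
  have \<alpha>yw: "\<alpha> (y\<^sub>0, w) = (y\<^sub>0, v)" using fst[OF yw'] unfolding v_def by (simp add: prod_eq_iff)
  have v: "v \<in> W" using \<alpha> yw' \<alpha>yw unfolding regular_map_def by (metis PiE SigmaE2)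
  have \<beta>yv: "\<beta> (y\<^sub>0, v) = (y\<^sub>0, w)" using \<beta>\<alpha>[OF yw'] \<alpha>yw by simp
  obtain P Q where PQ: "polynomial_function P" "real_polynomial_function Q"
      "\<And>x. x \<in> U \<times> W \<Longrightarrow> Q x \<noteq> 0 \<and> \<beta> x = (1 / Q x) *\<^sub>R P x"
    by (rule regular_map_fraction[OF \<beta>]) (rule that)
  have slice: "polynomial_function (\<lambda>y :: 'y. (y, v))" for v :: 'k
    unfolding polynomial_function_iff_Basis_inner Basis_prod_def
    using real_polynomial_function.intros(1)[OF bounded_linear_inner_left] by auto
  have "polynomial_function (\<lambda>y. P (y, v))"
    using polynomial_function_compose[OF slice PQ(1)] by (simp add: o_def)
  then have p: "polynomial_function (\<lambda>y. snd (P (y, v)))"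
    using polynomial_function_compose[OF _ polynomial_function_bounded_linear[OF bounded_linear_snd],
        of "\<lambda>y. P (y, v)"] by (simp add: o_def)
  define \<sigma> where "\<sigma> y = (R y / (R y\<^sub>0 * Q (y\<^sub>0, v))) *\<^sub>R snd (P (y, v))" for y
  show ?thesis
  proof
    show "polynomial_function \<sigma>"
      unfolding \<sigma>_def using R(1) p
      by (intro polynomial_function_mult) (auto simp: real_polynomial_function_eq[symmetric])
    show "\<sigma> y\<^sub>0 = w"
      using PQ(3)[of "(y\<^sub>0, v)"] U(2) v R(3) \<beta>yv unfolding \<sigma>_def by (auto simp: prod_eq_iff)
    fix y assume y: "y \<in> Y"
    have sub: "subspace {v. (y, v) \<in> S}"
      using S y unfolding algebraic_subbundle_def by blast
    show "(y, \<sigma> y) \<in> S"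
    proof (cases "y \<in> A")
      case True
      then show ?thesis using subspace_0[OF sub] R(2) unfolding \<sigma>_def by simp
    next
      case False
      then have yv: "(y, v) \<in> U \<times> W" using A y v by simp
      then have \<beta>S: "\<beta> (y, v) \<in> S \<inter> (U \<times> UNIV)" using \<beta> unfolding regular_map_def by blast
      have "fst (\<beta> (y, v)) = y" using fst[OF \<beta>S] \<alpha>\<beta>[OF yv] by simp
      then have *: "(y, snd (\<beta> (y, v))) \<in> S" using \<beta>S by (metis IntD1 prod.collapse)
      have "snd (P (y, v)) = Q (y, v) *\<^sub>R snd (\<beta> (y, v))" using PQ(3)[OF yv] by simp
      then show ?thesis
        using subspace_scale[OF sub, of "snd (\<beta> (y, v))"] * unfolding \<sigma>_def by simp
    qed
  qed
qed


section \<open>Partitions of unity on compact sets\<close>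

text \<open>
  The functions are defined on a neighbourhood \<open>U\<close> of \<open>K\<close> and not merely on \<open>K\<close>: when \<open>K\<close> is
  the diagonal of a compact set, it is their behaviour off the diagonal that matters.
\<close>

lemma compact_partition_of_unity:
  fixes K :: "'a::metric_space set"
  assumes "compact K" "\<And>p. p \<in> K \<Longrightarrow> 0 < r p"
  obtains I \<rho> U where "finite I" "I \<subseteq> K" "open U" "K \<subseteq> U"
    "\<And>i. i \<in> I \<Longrightarrow> continuous_on U (\<rho> i)"
    "\<And>i q. i \<in> I \<Longrightarrow> q \<in> U \<Longrightarrow> 0 \<le> \<rho> i q"
    "\<And>q. q \<in> U \<Longrightarrow> (\<Sum>i\<in>I. \<rho> i q) = (1::real)"
    "\<And>i q. i \<in> I \<Longrightarrow> q \<in> U \<Longrightarrow> \<rho> i q \<noteq> 0 \<Longrightarrow> dist i q < r i"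
proof -
  have "K \<subseteq> (\<Union>p\<in>K. ball p (r p))"
    using assms(2) by auto
  then obtain I where I: "finite I" "I \<subseteq> K" "K \<subseteq> (\<Union>p\<in>I. ball p (r p))"
    using compactE_image[OF assms(1), of K "\<lambda>p. ball p (r p)"] by (metis open_ball)
  define \<beta> where "\<beta> i q = max 0 (r i - dist i q)" for i q
  define U where "U = (\<Union>p\<in>I. ball p (r p))"
  have \<beta>: "0 \<le> \<beta> i q" "continuous_on A (\<beta> i)" for i q A
    unfolding \<beta>_def by (auto intro!: continuous_intros)
  have pos: "0 < (\<Sum>i\<in>I. \<beta> i q)" if q: "q \<in> U" for q
  proof -
    obtain i where i: "i \<in> I" "dist i q < r i" using q unfolding U_def by auto
    have "0 < \<beta> i q" using i unfolding \<beta>_def by simp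
    also have "\<dots> \<le> (\<Sum>i\<in>I. \<beta> i q)" using i I \<beta> by (intro member_le_sum) auto
    finally show ?thesis .
  qed
  show ?thesis
  proof (rule that[of I U "\<lambda>i q. \<beta> i q / (\<Sum>j\<in>I. \<beta> j q)"])
    show "continuous_on U (\<lambda>q. \<beta> i q / (\<Sum>j\<in>I. \<beta> j q))" for i
      using pos by (intro continuous_intros \<beta>) force
    show "(\<Sum>i\<in>I. \<beta> i q / (\<Sum>j\<in>I. \<beta> j q)) = 1" if "q \<in> U" for q
      using pos[OF that] by (simp flip: sum_divide_distrib)
    show "0 \<le> \<beta> i q / (\<Sum>j\<in>I. \<beta> j q)" for i q
      using \<beta> by (simp add: sum_nonneg)
    show "dist i q < r i" if "\<beta> i q / (\<Sum>j\<in>I. \<beta> j q) \<noteq> 0" for i q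
      using that unfolding \<beta>_def by (auto split: if_splits simp: max_def)
  qed (use I in \<open>auto simp: U_def\<close>)
qed

lemma convex_combination_norm_le:
  fixes v :: "'i \<Rightarrow> 'a::real_normed_vector"
  assumes "(\<Sum>i\<in>I. \<rho> i) = 1" "\<And>i. i \<in> I \<Longrightarrow> 0 \<le> \<rho> i"
    "\<And>i. i \<in> I \<Longrightarrow> \<rho> i \<noteq> 0 \<Longrightarrow> norm (v i - c) \<le> e"
  shows "norm ((\<Sum>i\<in>I. \<rho> i *\<^sub>R v i) - c) \<le> e"
proof -
  have "(\<Sum>i\<in>I. \<rho> i *\<^sub>R v i) - c = (\<Sum>i\<in>I. \<rho> i *\<^sub>R (v i - c))"
    using assms(1) by (simp add: scaleR_diff_right sum_subtractf flip: scaleR_left.sum)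
  also have "norm \<dots> \<le> (\<Sum>i\<in>I. \<rho> i * e)"
  proof (rule sum_norm_le)
    show "norm (\<rho> i *\<^sub>R (v i - c)) \<le> \<rho> i * e" if "i \<in> I" for i
      using assms(2,3)[OF that] by (cases "\<rho> i = 0") (auto intro!: mult_left_mono)
  qed
  also have "\<dots> = e" using assms(1) by (simp flip: sum_distrib_right)
  finally show ?thesis .
qed

section \<open>Secants are nearly tangent\<close>

lemma increment_has_derivative:
  fixes P :: "'a::euclidean_space \<Rightarrow> real"
  assumes "continuous_on UNIV (\<lambda>(x, y). H x y)" "\<And>x y. P y - P x = H x y \<bullet> (y - x)"
  shows "(P has_derivative (\<lambda>v. H x x \<bullet> v)) (at x)"
proof -
  have "continuous_on UNIV (\<lambda>h. case (x, x + h) of (x, y) \<Rightarrow> H x y)"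
    by (rule continuous_on_compose2[OF assms(1)]) (auto intro!: continuous_intros)
  then have "continuous_on UNIV (\<lambda>h. H x (x + h))" by simp
  then have "((\<lambda>h. H x (x + h)) \<longlongrightarrow> H x (x + 0)) (at 0)"
    unfolding continuous_on_def by blast
  then have lim: "((\<lambda>h. norm (H x (x + h) - H x x)) \<longlongrightarrow> 0) (at 0)"
    by (simp add: tendsto_norm_zero_iff LIM_zero)
  have "norm (norm (P (x + h) - P x - H x x \<bullet> h) / norm h) \<le> norm (H x (x + h) - H x x)" for h
  proof -
    have "P (x + h) - P x - H x x \<bullet> h = (H x (x + h) - H x x) \<bullet> h"
      using assms(2)[of "x + h" x] by (simp add: inner_diff_left)
    then show ?thesis
      using Cauchy_Schwarz_ineq2[of "H x (x + h) - H x x" h] by (cases "h = 0") (auto simp: field_simps)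
  qed
  then have "((\<lambda>h. norm (P (x + h) - P x - H x x \<bullet> h) / norm h) \<longlongrightarrow> 0) (at 0)"
    by (intro Lim_null_comparison[OF _ lim]) (simp add: always_eventually)
  then show ?thesis
    by (simp add: has_derivative_at bounded_linear_inner_right)
qed

text \<open>
  The gradients at \<open>a\<close> of the polynomials vanishing on \<open>Y\<close> form a linear subspace, whose orthogonal complement is the
  tangent space by definition. So the normal part of a vector is the gradient of a single polynomial.
\<close>

lemma tangent_normal_decomposition:
  fixes Y :: "'a::euclidean_space set"
  obtains u n P where "b = u + n" "u \<in> tangent_space Y a"
    "real_polynomial_function P" "\<And>z. z \<in> Y \<Longrightarrow> P z = 0"
    "(P has_derivative (\<lambda>v. n \<bullet> v)) (at a)"
proof -
  define G where "G = {n. \<exists>P. real_polynomial_function P \<and> (\<forall>z\<in>Y. P z = 0) \<and>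
    (P has_derivative (\<lambda>v. n \<bullet> v)) (at a)}"
  have "subspace G"
  proof (rule subspaceI)
    have "((\<lambda>x. 0 :: real) has_derivative (\<lambda>v. 0 \<bullet> v)) (at a)"
      unfolding inner_zero_left by (rule has_derivative_const)
    moreover have "real_polynomial_function (\<lambda>x::'a. 0)" by auto
    ultimately show "0 \<in> G" unfolding G_def by blast
    show "x + y \<in> G" if "x \<in> G" "y \<in> G" for x y
    proof -
      obtain P Q where *: "real_polynomial_function P" "\<forall>z\<in>Y. P z = 0"
          "(P has_derivative (\<lambda>v. x \<bullet> v)) (at a)" "real_polynomial_function Q" "\<forall>z\<in>Y. Q z = 0"
          "(Q has_derivative (\<lambda>v. y \<bullet> v)) (at a)"
        using \<open>x \<in> G\<close> \<open>y \<in> G\<close> unfolding G_def by blast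
      have "((\<lambda>z. P z + Q z) has_derivative (\<lambda>v. (x + y) \<bullet> v)) (at a)"
        unfolding inner_add_left by (intro has_derivative_add *)
      moreover have "real_polynomial_function (\<lambda>z. P z + Q z)"
        by (intro real_polynomial_function.intros(3) *)
      moreover have "\<forall>z\<in>Y. P z + Q z = 0" using * by simp
      ultimately show ?thesis unfolding G_def by blast
    qed
    show "c *\<^sub>R x \<in> G" if "x \<in> G" for c x
    proof -
      obtain P where *: "real_polynomial_function P" "\<forall>z\<in>Y. P z = 0"
          "(P has_derivative (\<lambda>v. x \<bullet> v)) (at a)"
        using \<open>x \<in> G\<close> unfolding G_def by blast
      have "((\<lambda>z. c * P z) has_derivative (\<lambda>v. (c *\<^sub>R x) \<bullet> v)) (at a)"
        unfolding inner_scaleR_left by (intro has_derivative_mult_right *)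
      moreover have "real_polynomial_function (\<lambda>z. c * P z)"
        by (intro real_polynomial_function.intros(2,4) *)
      moreover have "\<forall>z\<in>Y. c * P z = 0" using * by simp
      ultimately show ?thesis unfolding G_def by blast
    qed
  qed
  then have spanG: "span G = G" by (simp add: span_eq_iff)
  obtain n u where nu: "n \<in> span G" "\<And>w. w \<in> span G \<Longrightarrow> orthogonal u w" "b = n + u"
    using orthogonal_subspace_decomp_exists[of G b] by metis
  have "u \<in> tangent_space Y a"
    unfolding tangent_space_def
  proof (intro CollectI allI impI)
    fix P :: "'a \<Rightarrow> real" assume P: "real_polynomial_function P \<and> (\<forall>z\<in>Y. P z = 0)"
    obtain H where H: "continuous_on UNIV (\<lambda>(x, y). H x y)" "\<And>x y. P y - P x = H x y \<bullet> (y - x)"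
      using polynomial_increment[of P] P by metis
    note D = increment_has_derivative[OF H, of a]
    have "H a a \<in> G" unfolding G_def using P D by blast
    then have "H a a \<bullet> u = 0"
      using nu(2)[unfolded spanG] by (metis inner_commute orthogonal_def)
    then show "frechet_derivative P (at a) u = 0"
      using frechet_derivative_at[OF D] by metis
  qed
  moreover obtain P where "real_polynomial_function P" "\<forall>z\<in>Y. P z = 0"
      "(P has_derivative (\<lambda>v. n \<bullet> v)) (at a)"
    using nu(1) spanG unfolding G_def by blast
  ultimately show ?thesis
    using that[of u n P] nu(3) by (simp add: add.commute)
qed

text \<open>
  Here \<open>0 = P z - P y = H y z \<bullet> (z - y)\<close>, and \<open>H y z\<close> is close to \<open>H a a = n\<close>.
\<close>

lemma secants_almost_orthogonal_to_conormals:
  fixes P :: "'a::euclidean_space \<Rightarrow> real"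
  assumes P: "real_polynomial_function P" "\<And>z. z \<in> Y \<Longrightarrow> P z = 0"
    and n: "(P has_derivative (\<lambda>v. n \<bullet> v)) (at a)" and e: "0 < e"
  shows "\<exists>r>0. \<forall>y\<in>Y. \<forall>z\<in>Y. dist a y < r \<longrightarrow> dist a z < r \<longrightarrow> \<bar>n \<bullet> (z - y)\<bar> \<le> e * norm (z - y)"
proof -
  obtain H where H: "continuous_on UNIV (\<lambda>(x, y). H x y)" "\<And>x y. P y - P x = H x y \<bullet> (y - x)"
    using polynomial_increment[OF P(1)] by metis
  have "H a a \<bullet> v = n \<bullet> v" for v
    using has_derivative_unique[OF increment_has_derivative[OF H, of a] n] by metis
  then have Haa: "H a a = n" using vector_eq_rdot by metis
  have "\<exists>d>0. \<forall>q\<in>UNIV. dist q (a, a) < d \<longrightarrow> dist (case q of (x, y) \<Rightarrow> H x y) (case (a, a) of (x, y) \<Rightarrow> H x y) < e"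
    using H(1) e unfolding continuous_on_iff by blast
  then obtain d where d: "d > 0" "\<And>y z. dist (y, z) (a, a) < d \<Longrightarrow> dist (H y z) n < e"
    using Haa by auto
  show ?thesis
  proof (intro exI[of _ "d / 2"] conjI ballI impI)
    fix y z assume yz: "y \<in> Y" "z \<in> Y" "dist a y < d / 2" "dist a z < d / 2"
    have "dist (y, z) (a, a) \<le> dist y a + dist z a"
      unfolding dist_Pair_Pair by (rule sqrt_sum_squares_le_sum) auto
    then have "dist (H y z) n < e" using yz d by (simp add: dist_commute)
    then have "norm (n - H y z) \<le> e" by (simp add: dist_norm norm_minus_commute)
    moreover have "n \<bullet> (z - y) = (n - H y z) \<bullet> (z - y)"
      using H(2)[of z y] P(2) yz by (simp add: inner_diff_left)
    ultimately show "\<bar>n \<bullet> (z - y)\<bar> \<le> e * norm (z - y)"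
      using Cauchy_Schwarz_ineq2[of "n - H y z" "z - y"]
      by (metis mult_right_mono norm_ge_zero order_trans)
  qed (use d in auto)
qed

text \<open>
  The vectors \<open>u b\<close> are the orthogonal projections of the basis vectors to the tangent space, so that the sum is
  the projection of \<open>z - y\<close>. The coordinates of the remaining normal part are the inner products of \<open>z - y\<close>
  with normal vectors \<open>n b\<close>, because an orthogonal projection is self-adjoint.
\<close>

lemma secants_approximately_tangent:
  fixes Y :: "'a::euclidean_space set"
  obtains u where "\<And>b. u b \<in> tangent_space Y a"
    "\<And>e. 0 < e \<Longrightarrow> \<exists>r>0. \<forall>y\<in>Y. \<forall>z\<in>Y. dist a y < r \<longrightarrow> dist a z < r \<longrightarrow>
       norm ((\<Sum>b\<in>Basis. ((z - y) \<bullet> b) *\<^sub>R u b) - (z - y)) \<le> e * norm (z - y)"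
proof -
  have "\<exists>u n P. b = u + n \<and> u \<in> tangent_space Y a \<and>
    real_polynomial_function P \<and> (\<forall>z\<in>Y. P z = 0) \<and> (P has_derivative (\<lambda>v. n \<bullet> v)) (at a)" for b
    by (rule tangent_normal_decomposition[of b Y a]) blast
  then obtain u n P where *: "\<And>b. b = u b + n b" "\<And>b. u b \<in> tangent_space Y a"
    "\<And>b. real_polynomial_function (P b)" "\<And>b z. z \<in> Y \<Longrightarrow> P b z = 0"
    "\<And>b. (P b has_derivative (\<lambda>v. n b \<bullet> v)) (at a)"
    by metis
  have orth: "n b \<bullet> u c = 0" for b c
  proof -
    have "frechet_derivative (P b) (at a) (u c) = 0"
      using *(2)[of c] *(3)[of b] *(4)[of _ b] unfolding tangent_space_def by auto
    then show ?thesis using frechet_derivative_at[OF *(5)[of b]] by metis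
  qed
  \<comment> \<open>Self-adjointness of the projection \<open>b \<mapsto> n b\<close>.\<close>
  have n_dot: "n b \<bullet> c = n c \<bullet> b" for b c
    using orth[of b c] orth[of c b] *(1)[of c] *(1)[of b]
    by (metis add_0 inner_add_right inner_commute)
  have err: "(\<Sum>b\<in>Basis. (x \<bullet> b) *\<^sub>R u b) - x = - (\<Sum>b\<in>Basis. (n b \<bullet> x) *\<^sub>R b)" for x
  proof -
    have "(\<Sum>b\<in>Basis. (x \<bullet> b) *\<^sub>R u b) = (\<Sum>b\<in>Basis. (x \<bullet> b) *\<^sub>R b - (x \<bullet> b) *\<^sub>R n b)"
      by (rule sum.cong[OF refl]) (metis *(1) add_diff_cancel_right' scaleR_diff_right)
    also have "\<dots> = x - (\<Sum>b\<in>Basis. (x \<bullet> b) *\<^sub>R n b)"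
      by (simp add: sum_subtractf euclidean_representation)
    also have "(\<Sum>b\<in>Basis. (x \<bullet> b) *\<^sub>R n b) = (\<Sum>b\<in>Basis. (n b \<bullet> x) *\<^sub>R b)"
    proof (rule euclidean_eqI)
      fix c :: 'a assume c: "c \<in> Basis"
      have "(\<Sum>b\<in>Basis. (x \<bullet> b) *\<^sub>R n b) \<bullet> c = (\<Sum>b\<in>Basis. (x \<bullet> b) * (n c \<bullet> b))"
        by (simp add: inner_sum_left n_dot[of _ c])
      also have "\<dots> = n c \<bullet> x"
        by (simp add: euclidean_inner[of "n c" x] mult.commute)
      finally show "(\<Sum>b\<in>Basis. (x \<bullet> b) *\<^sub>R n b) \<bullet> c = (\<Sum>b\<in>Basis. (n b \<bullet> x) *\<^sub>R b) \<bullet> c"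
        using c by simp
    qed
    finally show ?thesis by simp
  qed
  show ?thesis
  proof (rule that[of u])
    fix e :: real assume e: "0 < e"
    have "\<exists>r>0. \<forall>y\<in>Y. \<forall>z\<in>Y. dist a y < r \<longrightarrow> dist a z < r \<longrightarrow>
        \<bar>n b \<bullet> (z - y)\<bar> \<le> e / DIM('a) * norm (z - y)" for b
      by (rule secants_almost_orthogonal_to_conormals[OF *(3,4,5)]) (use e in auto)
    then obtain r where r: "\<And>b. 0 < r b" "\<And>b y z. y \<in> Y \<Longrightarrow> z \<in> Y \<Longrightarrow> dist a y < r b \<Longrightarrow>
        dist a z < r b \<Longrightarrow> \<bar>n b \<bullet> (z - y)\<bar> \<le> e / DIM('a) * norm (z - y)"
      by metis
    show "\<exists>r>0. \<forall>y\<in>Y. \<forall>z\<in>Y. dist a y < r \<longrightarrow> dist a z < r \<longrightarrow>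
       norm ((\<Sum>b\<in>Basis. ((z - y) \<bullet> b) *\<^sub>R u b) - (z - y)) \<le> e * norm (z - y)"
    proof (intro exI[of _ "Min (r ` Basis)"] conjI ballI impI)
      show "0 < Min (r ` Basis)" using r(1) by (subst Min_gr_iff) auto
      fix y z assume yz: "y \<in> Y" "z \<in> Y" "dist a y < Min (r ` Basis)" "dist a z < Min (r ` Basis)"
      have "norm (\<Sum>b\<in>Basis. (n b \<bullet> (z - y)) *\<^sub>R b) \<le> (\<Sum>b\<in>(Basis::'a set). e / DIM('a) * norm (z - y))"
      proof (rule sum_norm_le)
        fix b :: 'a assume b: "b \<in> Basis"
        then have "Min (r ` Basis) \<le> r b" by simp
        then have "dist a y < r b" "dist a z < r b" using yz by linarith+
        then show "norm ((n b \<bullet> (z - y)) *\<^sub>R b) \<le> e / DIM('a) * norm (z - y)"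
          using r(2)[of y z b] yz b by simp
      qed
      then show "norm ((\<Sum>b\<in>Basis. ((z - y) \<bullet> b) *\<^sub>R u b) - (z - y)) \<le> e * norm (z - y)"
        unfolding err norm_minus_cancel by simp
    qed
  qed (use * in auto)
qed


section \<open>Approximate lifts near the diagonal\<close>

lemma linear_norm_le_Basis:
  fixes g :: "'a::euclidean_space \<Rightarrow> 'b::real_normed_vector"
  assumes "linear g"
  shows "norm (g x) \<le> norm x * (\<Sum>b\<in>Basis. norm (g b))"
proof -
  have "g x = g (\<Sum>b\<in>Basis. (x \<bullet> b) *\<^sub>R b)" by (simp add: euclidean_representation)
  also have "\<dots> = (\<Sum>b\<in>Basis. (x \<bullet> b) *\<^sub>R g b)"
    by (simp add: linear_sum[OF assms] linear_scale[OF assms])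
  also have "norm \<dots> \<le> (\<Sum>b\<in>Basis. norm x * norm (g b))"
    by (rule sum_norm_le) (auto intro!: mult_right_mono simp: Basis_le_norm)
  finally show ?thesis by (simp add: sum_distrib_left)
qed

text \<open>
  The outcome of \<open>dominating_quasi_spray_on_subbundle\<close> together with an increment matrix of \<open>T\<close>.
\<close>

locale dominating_fibre_map =
  fixes Y V :: "'y::euclidean_space set" and S :: "('y \<times> 'k::euclidean_space) set"
    and T :: "'y \<times> 'k \<Rightarrow> 'y" and \<omega> :: "'y \<Rightarrow> 'k"
    and M :: "'y \<times> 'k \<Rightarrow> 'y \<times> 'k \<Rightarrow> 'y \<times> 'k \<Rightarrow> 'y"
  assumes S: "algebraic_subbundle Y S"
    and V: "openin (top_of_set Y) V"
    and \<omega>_cont: "continuous_on V \<omega>"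
    and \<omega>: "\<And>y. y \<in> V \<Longrightarrow> (y, \<omega> y) \<in> S" "\<And>y. y \<in> V \<Longrightarrow> T (y, \<omega> y) = y"
    and M: "increment_matrix S T M"
    and onto: "\<And>y u. y \<in> V \<Longrightarrow> u \<in> tangent_space Y y \<Longrightarrow>
       \<exists>w. (y, w) \<in> S \<and> ((\<lambda>t. T (y, \<omega> y + t *\<^sub>R w)) has_vector_derivative u) (at 0)"
begin

text \<open>
  The derivative of \<open>T (y, \<cdot>)\<close> at \<open>\<omega> y\<close> on the fibre over \<open>y\<close>, extended linearly to all of \<open>'k\<close>.
\<close>

definition vderiv :: "'y \<Rightarrow> 'k \<Rightarrow> 'y" where
  "vderiv y w = M (y, \<omega> y) (y, \<omega> y) (0, w)"

lemma V_subset: "V \<subseteq> Y"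
  using V by (rule openin_imp_subset)

lemma fibre_subspace: "y \<in> Y \<Longrightarrow> subspace {w. (y, w) \<in> S}"
  using S unfolding algebraic_subbundle_def by blast

lemma linear_M: "linear (M p q)"
  using M unfolding increment_matrix_def by blast

lemma linear_M_vertical: "linear (\<lambda>w. M p q (0, w))"
  using linear_add[OF linear_M, of p q "(0, _)" "(0, _)"] linear_scale[OF linear_M, of p q _ "(0, _)"]
  by (intro linearI) simp_all

lemma linear_vderiv: "linear (vderiv y)"
  unfolding vderiv_def by (rule linear_M_vertical)

lemma vderiv_onto:
  assumes y: "y \<in> V" and u: "u \<in> tangent_space Y y"
  obtains w where "(y, w) \<in> S" "vderiv y w = u"
proof -
  obtain w where w: "(y, w) \<in> S" "((\<lambda>t. T (y, \<omega> y + t *\<^sub>R w)) has_vector_derivative u) (at 0)"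
    using onto[OF y u] by blast
  have sub: "subspace {w. (y, w) \<in> S}" using y V_subset fibre_subspace by blast
  have "(y, \<omega> y + t *\<^sub>R w) \<in> S" for t
    using subspace_add[OF sub, of "\<omega> y" "t *\<^sub>R w"] subspace_scale[OF sub, of w t] w(1) \<omega>(1)[OF y] by simp
  then have "((\<lambda>t. T ((y, \<omega> y) + t *\<^sub>R (0, w))) has_vector_derivative M (y, \<omega> y) (y, \<omega> y) (0, w)) (at 0)"
    by (intro increment_matrix_line_derivative[OF M]) simp
  then have "vderiv y w = u"
    using vector_derivative_unique_at[OF _ w(2)] unfolding vderiv_def by simp
  with w(1) show ?thesis by (rule that)
qed

lemma vderiv_continuous:
  assumes "continuous_on B p" "continuous_on B w" "p ` B \<subseteq> V"
  shows "continuous_on B (\<lambda>x. vderiv (p x) (w x))"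
proof -
  have "continuous_on B (\<lambda>x. \<omega> (p x))"
    by (rule continuous_on_compose2[OF \<omega>_cont assms(1,3)])
  then show ?thesis
    unfolding vderiv_def using assms \<omega>(1)
    by (intro increment_matrix_continuous[OF M] continuous_intros) auto
qed

text \<open>
  At \<open>p\<close> the vertical derivative maps suitable vectors \<open>w\<^sub>b\<close> of the fibre to the projections \<open>u b\<close> of the basis
  vectors to the tangent space. Polynomial sections \<open>\<sigma> b\<close> with \<open>\<sigma> b p = w\<^sub>b\<close> spread these vectors to the nearby fibres,
  and \<open>f y z\<close> combines them with the coordinates of \<open>z - y\<close>. The error is small near \<open>p\<close> by continuity
  and since secants near \<open>p\<close> are almost tangent at \<open>p\<close>.
\<close>

lemma local_linear_lift:
  assumes p: "p \<in> V"
  shows "\<exists>r>0. \<exists>C\<ge>0. \<exists>f. continuous_on UNIV (\<lambda>(y, z). f y z) \<and>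
    (\<forall>y\<in>Y. \<forall>z. (y, f y z) \<in> S) \<and>
    (\<forall>y\<in>Y. \<forall>z\<in>Y. dist p y < r \<longrightarrow> dist p z < r \<longrightarrow> y \<in> V \<and>
       norm (vderiv y (f y z) - (z - y)) \<le> norm (z - y) / 4 \<and> norm (f y z) \<le> C * norm (z - y))"
proof -
  obtain u where u: "\<And>b. u b \<in> tangent_space Y p"
    and "\<And>e. 0 < e \<Longrightarrow> \<exists>r>0. \<forall>y\<in>Y. \<forall>z\<in>Y. dist p y < r \<longrightarrow> dist p z < r \<longrightarrow>
       norm ((\<Sum>b\<in>Basis. ((z - y) \<bullet> b) *\<^sub>R u b) - (z - y)) \<le> e * norm (z - y)"
    by (rule secants_approximately_tangent[of Y p]) (rule that)
  from this(2)[of "1 / 8"] obtain r1 where r1: "0 < r1"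
    "\<And>y z. y \<in> Y \<Longrightarrow> z \<in> Y \<Longrightarrow> dist p y < r1 \<Longrightarrow> dist p z < r1 \<Longrightarrow>
       norm ((\<Sum>b\<in>Basis. ((z - y) \<bullet> b) *\<^sub>R u b) - (z - y)) \<le> norm (z - y) / 8"
    by auto
  have "\<exists>\<sigma>. polynomial_function \<sigma> \<and> (\<forall>y\<in>Y. (y, \<sigma> y) \<in> S) \<and> vderiv p (\<sigma> p) = u b" for b
  proof -
    obtain w where w: "(p, w) \<in> S" "vderiv p w = u b" by (rule vderiv_onto[OF p u])
    obtain \<sigma> where "polynomial_function \<sigma>" "\<And>y. y \<in> Y \<Longrightarrow> (y, \<sigma> y) \<in> S" "\<sigma> p = w"
      by (rule algebraic_subbundle_polynomial_section[OF S w(1)]) (rule that)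
    then show ?thesis using w(2) by blast
  qed
  then obtain \<sigma> where \<sigma>: "\<And>b. polynomial_function (\<sigma> b)" "\<And>b y. y \<in> Y \<Longrightarrow> (y, \<sigma> b y) \<in> S"
    "\<And>b. vderiv p (\<sigma> b p) = u b" by metis
  have \<sigma>_cont: "continuous_on B (\<sigma> b)" for b B
    using \<sigma>(1) by (rule continuous_on_polymonial_function)
  define f where "f y z = (\<Sum>b\<in>Basis. ((z - y) \<bullet> b) *\<^sub>R \<sigma> b y)" for y z
  define C where "C = (\<Sum>b\<in>Basis. norm (\<sigma> b p)) + 1"
  have "continuous_on V (\<lambda>y. \<Sum>b\<in>Basis. norm (vderiv y (\<sigma> b y) - u b))"
    by (intro continuous_intros vderiv_continuous \<sigma>_cont) auto
  from this[unfolded continuous_on_iff, rule_format, OF p, of "1 / 8"]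
  have "\<exists>d>0. \<forall>y\<in>V. dist y p < d \<longrightarrow> dist (\<Sum>b\<in>Basis. norm (vderiv y (\<sigma> b y) - u b))
      (\<Sum>b\<in>Basis. norm (vderiv p (\<sigma> b p) - u b)) < 1 / 8"
    by simp
  then obtain r2 where r2: "0 < r2" "\<And>y. y \<in> V \<Longrightarrow> dist y p < r2 \<Longrightarrow>
      (\<Sum>b\<in>Basis. norm (vderiv y (\<sigma> b y) - u b)) < 1 / 8"
    using \<sigma>(3) by (auto simp: dist_real_def abs_of_nonneg sum_nonneg)
  have "continuous_on UNIV (\<lambda>y. \<Sum>b\<in>Basis. norm (\<sigma> b y))"
    by (intro continuous_intros \<sigma>_cont)
  then have "\<exists>d>0. \<forall>y\<in>UNIV. dist y p < d \<longrightarrow> dist (\<Sum>b\<in>Basis. norm (\<sigma> b y)) (\<Sum>b\<in>Basis. norm (\<sigma> b p)) < 1"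
    unfolding continuous_on_iff by (metis UNIV_I zero_less_one)
  then obtain r3 where r3: "0 < r3" "\<And>y. dist y p < r3 \<Longrightarrow>
      dist (\<Sum>b\<in>Basis. norm (\<sigma> b y)) (\<Sum>b\<in>Basis. norm (\<sigma> b p)) < 1"
    by blast
  have C: "(\<Sum>b\<in>Basis. norm (\<sigma> b y)) \<le> C" if "dist y p < r3" for y
    using r3(2)[OF that] unfolding C_def dist_real_def by linarith
  obtain r4 where r4: "0 < r4" "\<And>y. y \<in> Y \<Longrightarrow> dist y p < r4 \<Longrightarrow> y \<in> V"
    using V p unfolding openin_euclidean_subtopology_iff by metis
  define r where "r = min (min r1 r2) (min r3 r4)"
  have r: "0 < r" using r1 r2 r3 r4 unfolding r_def by simp
  have C0: "0 \<le> C" unfolding C_def by (simp add: sum_nonneg add_nonneg_nonneg)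
  show ?thesis
  proof (rule exI[of _ r], rule conjI[OF r], rule exI[of _ C], rule conjI[OF C0],
      rule exI[of _ f], intro conjI ballI allI impI)
    show "continuous_on UNIV (\<lambda>(y, z). f y z)"
      unfolding f_def case_prod_unfold
      by (intro continuous_intros continuous_on_compose2[OF \<sigma>_cont[of UNIV]]) auto
    show "(y, f y z) \<in> S" if "y \<in> Y" for y z
    proof -
      have sub: "subspace {w. (y, w) \<in> S}" using that by (rule fibre_subspace)
      have "f y z \<in> {w. (y, w) \<in> S}"
        unfolding f_def using \<sigma>(2)[OF that] by (intro subspace_sum[OF sub] subspace_scale[OF sub]) simp
      then show ?thesis by simp
    qed
    fix y z assume yz: "y \<in> Y" "z \<in> Y" "dist p y < r" "dist p z < r"
    show yV: "y \<in> V" using r4(2)[OF yz(1)] yz(3) unfolding r_def by (simp add: dist_commute)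
    have le: "norm (\<Sum>b\<in>Basis. ((z - y) \<bullet> b) *\<^sub>R g b) \<le> norm (z - y) * (\<Sum>b\<in>Basis. norm (g b))"
      for g :: "'y \<Rightarrow> 'c::real_normed_vector"
      unfolding sum_distrib_left
      by (rule sum_norm_le) (auto intro!: mult_right_mono simp: Basis_le_norm)
    show "norm (f y z) \<le> C * norm (z - y)"
    proof -
      have "norm (f y z) \<le> norm (z - y) * (\<Sum>b\<in>Basis. norm (\<sigma> b y))"
        unfolding f_def by (rule le)
      also have "\<dots> \<le> norm (z - y) * C"
        using C[of y] yz(3) unfolding r_def by (intro mult_left_mono) (auto simp: dist_commute)
      finally show ?thesis by (simp add: mult.commute)
    qed
    show "norm (vderiv y (f y z) - (z - y)) \<le> norm (z - y) / 4"
    proof -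
      let ?U = "\<Sum>b\<in>Basis. ((z - y) \<bullet> b) *\<^sub>R u b"
      have "vderiv y (f y z) - ?U = (\<Sum>b\<in>Basis. ((z - y) \<bullet> b) *\<^sub>R (vderiv y (\<sigma> b y) - u b))"
        unfolding f_def by (simp add: linear_sum[OF linear_vderiv] linear_scale[OF linear_vderiv]
            scaleR_diff_right sum_subtractf)
      then have "norm (vderiv y (f y z) - ?U) \<le> norm (z - y) * (\<Sum>b\<in>Basis. norm (vderiv y (\<sigma> b y) - u b))"
        using le by simp
      also have "\<dots> \<le> norm (z - y) * (1 / 8)"
        using r2(2)[OF yV] yz(3) unfolding r_def by (intro mult_left_mono) (auto simp: dist_commute)
      finally have "norm (vderiv y (f y z) - ?U) \<le> norm (z - y) / 8" by simp
      moreover have "norm (?U - (z - y)) \<le> norm (z - y) / 8"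
        using r1(2)[OF yz(1,2)] yz(3,4) unfolding r_def by simp
      ultimately show ?thesis
        using norm_diff_triangle_le[of "vderiv y (f y z)" ?U "norm (z - y) / 8" "z - y" "norm (z - y) / 8"]
        by simp
    qed
  qed
qed

text \<open>
  For a fixed pair \<open>(y, z)\<close> the conditions that \<open>\<eta>\<close> lies in the fibre over \<open>y\<close>, that \<open>vderiv y \<eta>\<close> is within
  \<open>norm (z - y) / 4\<close> of \<open>z - y\<close>, and that \<open>\<eta>\<close> is bounded by a multiple of \<open>norm (z - y)\<close> are convex in \<open>\<eta>\<close>. So
  the local solutions can be glued over a neighbourhood of the diagonal of \<open>L\<close>. The deviation of \<open>T (y, \<omega> y + \<eta>)\<close> from
  its linearization \<open>y + vderiv y \<eta>\<close> costs at most another \<open>norm (z - y) / 4\<close>, since its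
  coefficient depends continuously on the pair and vanishes on the diagonal.
\<close>

lemma approximate_lift_near_diagonal:
  assumes L: "compact L" "L \<subseteq> V"
  obtains d v where "0 < d"
    "continuous_on {(y, z). y \<in> Y \<and> z \<in> L \<and> dist y z < d} (\<lambda>(y, z). v y z)"
    "\<And>y z. y \<in> Y \<Longrightarrow> z \<in> L \<Longrightarrow> dist y z < d \<Longrightarrow>
       (y, v y z) \<in> S \<and> dist (T (y, v y z)) z \<le> dist y z / 2"
proof -
  have "\<forall>p\<in>L. \<exists>r C f. 0 < r \<and> 0 \<le> C \<and> continuous_on UNIV (\<lambda>(y, z). f y z) \<and>
    (\<forall>y\<in>Y. \<forall>z. (y, f y z) \<in> S) \<and>
    (\<forall>y\<in>Y. \<forall>z\<in>Y. dist p y < r \<longrightarrow> dist p z < r \<longrightarrow> y \<in> V \<and>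
       norm (vderiv y (f y z) - (z - y)) \<le> norm (z - y) / 4 \<and> norm (f y z) \<le> C * norm (z - y))"
  proof
    fix p assume "p \<in> L"
    then have "p \<in> V" using L(2) by blast
    from local_linear_lift[OF this] show "\<exists>r C f. 0 < r \<and> 0 \<le> C \<and> continuous_on UNIV (\<lambda>(y, z). f y z) \<and>
      (\<forall>y\<in>Y. \<forall>z. (y, f y z) \<in> S) \<and>
      (\<forall>y\<in>Y. \<forall>z\<in>Y. dist p y < r \<longrightarrow> dist p z < r \<longrightarrow> y \<in> V \<and>
         norm (vderiv y (f y z) - (z - y)) \<le> norm (z - y) / 4 \<and> norm (f y z) \<le> C * norm (z - y))"
      by (elim exE conjE) (intro exI conjI; assumption)
  qed
  then have "\<exists>r C f. \<forall>p\<in>L. 0 < r p \<and> 0 \<le> C p \<and> continuous_on UNIV (\<lambda>(y, z). f p y z) \<and>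
    (\<forall>y\<in>Y. \<forall>z. (y, f p y z) \<in> S) \<and>
    (\<forall>y\<in>Y. \<forall>z\<in>Y. dist p y < r p \<longrightarrow> dist p z < r p \<longrightarrow> y \<in> V \<and>
       norm (vderiv y (f p y z) - (z - y)) \<le> norm (z - y) / 4 \<and> norm (f p y z) \<le> C p * norm (z - y))"
    by (simp only: bchoice_iff)
  then obtain r C f where *: "\<forall>p\<in>L. 0 < r p \<and> 0 \<le> C p \<and> continuous_on UNIV (\<lambda>(y, z). f p y z) \<and>
    (\<forall>y\<in>Y. \<forall>z. (y, f p y z) \<in> S) \<and>
    (\<forall>y\<in>Y. \<forall>z\<in>Y. dist p y < r p \<longrightarrow> dist p z < r p \<longrightarrow> y \<in> V \<and>
       norm (vderiv y (f p y z) - (z - y)) \<le> norm (z - y) / 4 \<and> norm (f p y z) \<le> C p * norm (z - y))"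
    by (elim exE) (rule that)
  have r: "\<And>p. p \<in> L \<Longrightarrow> 0 < r p" and C0: "\<And>p. p \<in> L \<Longrightarrow> (0::real) \<le> C p"
    and f_cont: "\<And>p. p \<in> L \<Longrightarrow> continuous_on UNIV (\<lambda>(y, z). f p y z)"
    and f_in: "\<And>p y z. p \<in> L \<Longrightarrow> y \<in> Y \<Longrightarrow> (y, f p y z) \<in> S"
    and f_lift: "\<And>p y z. p \<in> L \<Longrightarrow> y \<in> Y \<Longrightarrow> z \<in> Y \<Longrightarrow> dist p y < r p \<Longrightarrow> dist p z < r p \<Longrightarrow> y \<in> V \<and>
       norm (vderiv y (f p y z) - (z - y)) \<le> norm (z - y) / 4 \<and> norm (f p y z) \<le> C p * norm (z - y)"
    using * by blast+
  define D where "D = (\<lambda>p. (p, p)) ` L"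
  have "compact D"
    unfolding D_def by (intro compact_continuous_image L(1) continuous_intros)
  moreover have "0 < r (fst q)" if "q \<in> D" for q
    using that r unfolding D_def by auto
  ultimately obtain I \<rho> U where I: "finite I" "I \<subseteq> D" and U: "open U" "D \<subseteq> U"
    and \<rho>_cont: "\<And>i. i \<in> I \<Longrightarrow> continuous_on U (\<rho> i)"
    and \<rho>_nonneg: "\<And>i q. i \<in> I \<Longrightarrow> q \<in> U \<Longrightarrow> 0 \<le> \<rho> i q"
    and \<rho>_sum: "\<And>q. q \<in> U \<Longrightarrow> (\<Sum>i\<in>I. \<rho> i q) = (1::real)"
    and \<rho>_supp: "\<And>i q. i \<in> I \<Longrightarrow> q \<in> U \<Longrightarrow> \<rho> i q \<noteq> 0 \<Longrightarrow> dist i q < r (fst i)"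
    by (rule compact_partition_of_unity[of D "\<lambda>q. r (fst q)"]) (simp, rule that)
  \<comment> \<open>The balls are centred at points of the diagonal, and the local solution belonging to the
    ball around \<open>(p, p)\<close> is \<open>f p\<close>.\<close>
  define \<eta> where "\<eta> q = (\<Sum>i\<in>I. \<rho> i q *\<^sub>R f (fst i) (fst q) (snd q))" for q
  define c where "c = (\<Sum>i\<in>I. C (fst i))"
  define Q where "Q = U \<inter> (Y \<times> Y)"
  have IL: "fst i \<in> L" "i = (fst i, fst i)" if "i \<in> I" for i
    using that I(2) unfolding D_def by auto
  have c0: "0 \<le> c" unfolding c_def using C0 IL(1) by (auto intro!: sum_nonneg)
  have local: "fst q \<in> V \<and> norm (vderiv (fst q) (f (fst i) (fst q) (snd q)) - (snd q - fst q)) \<le> norm (snd q - fst q) / 4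
      \<and> norm (f (fst i) (fst q) (snd q)) \<le> c * norm (snd q - fst q)"
    if q: "q \<in> Q" and i: "i \<in> I" "\<rho> i q \<noteq> 0" for q i
  proof -
    have "dist i q < r (fst i)" using \<rho>_supp i q unfolding Q_def by blast
    then have "dist (fst i) (fst q) < r (fst i)" "dist (fst i) (snd q) < r (fst i)"
      using IL(2)[OF i(1)] dist_fst_le[of i q] dist_snd_le[of i q] by (metis le_less_trans snd_conv)+
    then have *: "fst q \<in> V \<and> norm (vderiv (fst q) (f (fst i) (fst q) (snd q)) - (snd q - fst q)) \<le> norm (snd q - fst q) / 4
      \<and> norm (f (fst i) (fst q) (snd q)) \<le> C (fst i) * norm (snd q - fst q)"
      using f_lift[OF IL(1)[OF i(1)], of "fst q" "snd q"] q unfolding Q_def by auto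
    moreover have "C (fst i) \<le> c"
      unfolding c_def using I(1) i(1) C0 IL(1) by (intro member_le_sum) auto
    then have "C (fst i) * norm (snd q - fst q) \<le> c * norm (snd q - fst q)"
      by (intro mult_right_mono) auto
    ultimately show ?thesis by linarith
  qed
  have QV: "fst q \<in> V" if "q \<in> Q" for q
  proof -
    have "(\<Sum>i\<in>I. \<rho> i q) \<noteq> 0" using \<rho>_sum that unfolding Q_def by simp
    then obtain i where "i \<in> I" "\<rho> i q \<noteq> 0" by (rule sum.not_neutral_contains_not_neutral)
    then show ?thesis using local[OF that] by blast
  qed
  have \<eta>_in: "(fst q, \<eta> q) \<in> S" if "q \<in> Q" for q
  proof -
    have y: "fst q \<in> Y" using that unfolding Q_def by auto
    have "\<eta> q \<in> {w. (fst q, w) \<in> S}"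
      unfolding \<eta>_def using f_in IL(1) y
      by (intro subspace_sum[OF fibre_subspace] subspace_scale[OF fibre_subspace]) auto
    then show ?thesis by simp
  qed
  have \<eta>_bound: "norm (\<eta> q) \<le> c * norm (snd q - fst q)" if "q \<in> Q" for q
    using convex_combination_norm_le[of "\<lambda>i. \<rho> i q" I "\<lambda>i. f (fst i) (fst q) (snd q)" 0]
      \<rho>_sum \<rho>_nonneg local[OF that] that unfolding \<eta>_def Q_def by simp
  have vderiv_\<eta>: "norm (vderiv (fst q) (\<eta> q) - (snd q - fst q)) \<le> norm (snd q - fst q) / 4" if "q \<in> Q" for q
  proof -
    have "vderiv (fst q) (\<eta> q) = (\<Sum>i\<in>I. \<rho> i q *\<^sub>R vderiv (fst q) (f (fst i) (fst q) (snd q)))"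
      unfolding \<eta>_def by (simp add: linear_sum[OF linear_vderiv] linear_scale[OF linear_vderiv])
    moreover have "norm (\<dots> - (snd q - fst q)) \<le> norm (snd q - fst q) / 4"
      by (rule convex_combination_norm_le)
         (use \<rho>_sum \<rho>_nonneg local[OF that] that in \<open>auto simp: Q_def\<close>)
    ultimately show ?thesis by simp
  qed
  have \<eta>_cont: "continuous_on Q \<eta>"
  proof -
    have "continuous_on Q (\<rho> i)" if "i \<in> I" for i
      using \<rho>_cont[OF that] by (rule continuous_on_subset) (auto simp: Q_def)
    moreover have "continuous_on Q (\<lambda>q. f (fst i) (fst q) (snd q))" if "i \<in> I" for i
      using f_cont[OF IL(1)[OF that]] by (auto simp: case_prod_unfold intro: continuous_on_subset)
    ultimately show ?thesis
      unfolding \<eta>_def by (intro continuous_intros) auto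
  qed
  define v where "v q = \<omega> (fst q) + \<eta> q" for q
  have v_cont: "continuous_on Q v"
    unfolding v_def
    by (intro continuous_intros \<eta>_cont continuous_on_compose2[OF \<omega>_cont continuous_on_fst[OF continuous_on_id]])
       (use QV in auto)
  have v_in: "(fst q, v q) \<in> S" if "q \<in> Q" for q
  proof -
    have "fst q \<in> Y" using that unfolding Q_def by auto
    then show ?thesis
      using subspace_add[OF fibre_subspace, of "fst q" "\<omega> (fst q)" "\<eta> q"] \<omega>(1)[OF QV[OF that]] \<eta>_in[OF that]
      unfolding v_def by simp
  qed
  \<comment> \<open>The error of linearization is \<open>g q (\<eta> q)\<close>, and \<open>\<mu> q\<close> bounds the norm of the linear map \<open>g q\<close>. On the
    diagonal \<open>\<eta> q = 0\<close>, so \<open>v q = \<omega> (fst q)\<close> and \<open>\<mu> q = 0\<close>; hence \<open>c * \<mu> q < 1/4\<close> nearby.\<close>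
  define g where "g q w = M (fst q, \<omega> (fst q)) (fst q, v q) (0, w) - vderiv (fst q) w" for q w
  define \<mu> where "\<mu> q = (\<Sum>b\<in>Basis. norm (g q b))" for q
  have g_linear: "linear (g q)" for q
    unfolding g_def by (intro linear_compose_sub linear_M_vertical linear_vderiv)
  have "continuous_on Q (\<lambda>q. g q b)" for b
    unfolding g_def
    by (intro continuous_intros vderiv_continuous increment_matrix_continuous[OF M] v_cont
          continuous_on_compose2[OF \<omega>_cont continuous_on_fst[OF continuous_on_id]])
       (use QV \<omega>(1) v_in in auto)
  then have "continuous_on Q (\<lambda>q. c * \<mu> q)"
    unfolding \<mu>_def by (intro continuous_intros)
  then have "openin (top_of_set Q) (Q \<inter> (\<lambda>q. c * \<mu> q) -` {..<1/4})"
    by (rule continuous_openin_preimage_gen) simp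
  then obtain G where G: "open G" "Q \<inter> (\<lambda>q. c * \<mu> q) -` {..<1/4} = Q \<inter> G"
    unfolding openin_open by blast
  have "D \<subseteq> U \<inter> G"
  proof
    fix q assume q: "q \<in> D"
    then have qQ: "q \<in> Q" and eq: "snd q = fst q"
      using U(2) L(2) V_subset unfolding Q_def D_def by auto
    have "\<eta> q = 0" using \<eta>_bound[OF qQ] eq by simp
    then have "g q b = 0" for b unfolding g_def v_def vderiv_def by simp
    then have "c * \<mu> q < 1 / 4" unfolding \<mu>_def by simp
    then show "q \<in> U \<inter> G" using G(2) qQ unfolding Q_def by blast
  qed
  moreover have "open (U \<inter> G)" using U(1) G(1) by blast
  ultimately obtain d where d: "0 < d" "(\<Union>q\<in>D. ball q d) \<subseteq> U \<inter> G"
    using compact_subset_open_imp_ball_epsilon_subset[OF \<open>compact D\<close>] by metis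
  have near: "(y, z) \<in> Q \<inter> G" if "y \<in> Y" "z \<in> L" "dist y z < d" for y z
  proof -
    have "(y, z) \<in> ball (z, z) d" using that(3) by (simp add: dist_Pair_Pair dist_commute)
    moreover have "(z, z) \<in> D" using that(2) unfolding D_def by blast
    ultimately have "(y, z) \<in> U \<inter> G" using d(2) by blast
    then show ?thesis using that L(2) V_subset unfolding Q_def by blast
  qed
  show ?thesis
  proof (rule that[of d "\<lambda>y z. v (y, z)"])
    show "0 < d" by (rule d(1))
    show "continuous_on {(y, z). y \<in> Y \<and> z \<in> L \<and> dist y z < d} (\<lambda>(y, z). v (y, z))"
      using continuous_on_subset[OF v_cont, of "{(y, z). y \<in> Y \<and> z \<in> L \<and> dist y z < d}"] near by auto
    fix y z assume yz: "y \<in> Y" "z \<in> L" "dist y z < d"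
    let ?q = "(y, z)"
    have q: "?q \<in> Q" and "c * \<mu> ?q < 1 / 4" using near[OF yz] G(2) by auto
    have yV: "y \<in> V" using QV[OF q] by simp
    have "T (y, v ?q) - T (y, \<omega> y) = M (y, \<omega> y) (y, v ?q) ((y, v ?q) - (y, \<omega> y))"
      using M \<omega>(1)[OF yV] v_in[OF q] unfolding increment_matrix_def by simp
    also have "(y, v ?q) - (y, \<omega> y) = (0, \<eta> ?q)" unfolding v_def by simp
    also have "M (y, \<omega> y) (y, v ?q) (0, \<eta> ?q) = g ?q (\<eta> ?q) + vderiv y (\<eta> ?q)" unfolding g_def by simp
    finally have "T (y, v ?q) - z = g ?q (\<eta> ?q) + (vderiv y (\<eta> ?q) - (z - y))"
      using \<omega>(2)[OF yV] by (simp add: algebra_simps)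
    moreover have "norm (g ?q (\<eta> ?q)) \<le> norm (z - y) / 4"
    proof -
      have "norm (g ?q (\<eta> ?q)) \<le> norm (\<eta> ?q) * \<mu> ?q"
        unfolding \<mu>_def by (rule linear_norm_le_Basis[OF g_linear])
      also have "\<dots> \<le> (c * norm (z - y)) * \<mu> ?q"
        using \<eta>_bound[OF q] unfolding \<mu>_def by (intro mult_right_mono) (auto intro: sum_nonneg)
      also have "\<dots> = norm (z - y) * (c * \<mu> ?q)" by simp
      also have "\<dots> \<le> norm (z - y) * (1 / 4)"
        using \<open>c * \<mu> ?q < 1 / 4\<close> by (intro mult_left_mono) auto
      finally show ?thesis by simp
    qed
    ultimately have "norm (T (y, v ?q) - z) \<le> norm (z - y) / 4 + norm (z - y) / 4"
      using vderiv_\<eta>[OF q] by (metis add_mono fst_conv norm_triangle_le snd_conv)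
    then show "(y, v ?q) \<in> S \<and> dist (T (y, v ?q)) z \<le> dist y z / 2"
      using v_in[OF q] by (simp add: dist_norm norm_minus_commute)
  qed
qed

end


section \<open>Approximation of sections\<close>

text \<open>
  A Weierstrass theorem for sections of the pulled back bundle: near each \<open>p\<close> the section \<open>v\<close> is approximated by the
  pullback of a polynomial section through \<open>(g p, v p)\<close>. A partition of unity combines these, and its members can be
  replaced by polynomials without leaving the fibres.
\<close>

lemma regular_approximation_of_section:
  fixes X K :: "'x::euclidean_space set" and Y :: "'y::euclidean_space set"
    and S :: "('y \<times> 'k::euclidean_space) set"
  assumes S: "algebraic_subbundle Y S" and g: "regular_map X Y g"
    and K: "compact K" "K \<subseteq> X"
    and v: "continuous_on K v" "\<And>x. x \<in> K \<Longrightarrow> (g x, v x) \<in> S" and e: "0 < e"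
  obtains w where "regular_map X S (\<lambda>x. (g x, w x))" "\<And>x. x \<in> K \<Longrightarrow> norm (w x - v x) < e"
proof -
  have gY: "g x \<in> Y" if "x \<in> X" for x using g that unfolding regular_map_def by blast
  have g_cont: "continuous_on K g"
    using regular_map_continuous_on[OF g] K(2) by (rule continuous_on_subset)
  have "\<forall>p\<in>K. \<exists>\<sigma>. polynomial_function \<sigma> \<and> (\<forall>y\<in>Y. (y, \<sigma> y) \<in> S) \<and> \<sigma> (g p) = v p"
  proof
    fix p assume "p \<in> K"
    then obtain \<sigma> where "polynomial_function \<sigma>" "\<And>y. y \<in> Y \<Longrightarrow> (y, \<sigma> y) \<in> S" "\<sigma> (g p) = v p"
      using algebraic_subbundle_polynomial_section[OF S v(2)] by metis
    then show "\<exists>\<sigma>. polynomial_function \<sigma> \<and> (\<forall>y\<in>Y. (y, \<sigma> y) \<in> S) \<and> \<sigma> (g p) = v p" by blast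
  qed
  then obtain \<sigma> where \<sigma>: "\<And>p. p \<in> K \<Longrightarrow> polynomial_function (\<sigma> p)"
    "\<And>p y. p \<in> K \<Longrightarrow> y \<in> Y \<Longrightarrow> (y, \<sigma> p y) \<in> S" "\<And>p. p \<in> K \<Longrightarrow> \<sigma> p (g p) = v p"
    by metis
  have \<sigma>g_cont: "continuous_on K (\<lambda>x. \<sigma> p (g x))" if "p \<in> K" for p
    by (rule continuous_on_compose2[OF continuous_on_polymonial_function[OF \<sigma>(1)[OF that], of UNIV] g_cont]) auto
  have "\<forall>p\<in>K. \<exists>r>0. \<forall>x\<in>K. dist x p < r \<longrightarrow> norm (\<sigma> p (g x) - v x) \<le> e / 2"
  proof
    fix p assume p: "p \<in> K"
    have "continuous_on K (\<lambda>x. \<sigma> p (g x) - v x)"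
      by (intro continuous_intros \<sigma>g_cont p v)
    from this[unfolded continuous_on_iff, rule_format, OF p, of "e / 2"] e \<sigma>(3)[OF p]
    obtain r where "r > 0" "\<forall>x\<in>K. dist x p < r \<longrightarrow> norm (\<sigma> p (g x) - v x) < e / 2" by auto
    then show "\<exists>r>0. \<forall>x\<in>K. dist x p < r \<longrightarrow> norm (\<sigma> p (g x) - v x) \<le> e / 2"
      by (meson less_imp_le)
  qed
  then obtain r where r: "\<And>p. p \<in> K \<Longrightarrow> 0 < r p"
    "\<And>p x. p \<in> K \<Longrightarrow> x \<in> K \<Longrightarrow> dist x p < r p \<Longrightarrow> norm (\<sigma> p (g x) - v x) \<le> e / 2"
    by metis
  obtain I \<rho> U where I: "finite I" "I \<subseteq> K" and U: "open U" "K \<subseteq> U"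
    and \<rho>_cont: "\<And>i. i \<in> I \<Longrightarrow> continuous_on U (\<rho> i)"
    and \<rho>_nonneg: "\<And>i q. i \<in> I \<Longrightarrow> q \<in> U \<Longrightarrow> 0 \<le> \<rho> i q"
    and \<rho>_sum: "\<And>q. q \<in> U \<Longrightarrow> (\<Sum>i\<in>I. \<rho> i q) = (1::real)"
    and \<rho>_supp: "\<And>i q. i \<in> I \<Longrightarrow> q \<in> U \<Longrightarrow> \<rho> i q \<noteq> 0 \<Longrightarrow> dist i q < r i"
    by (rule compact_partition_of_unity[OF K(1) r(1)]) (simp, rule that)
  have "continuous_on K (\<lambda>x. \<Sum>i\<in>I. norm (\<sigma> i (g x)))"
    using I(2) by (intro continuous_intros \<sigma>g_cont) auto
  then have "bounded ((\<lambda>x. \<Sum>i\<in>I. norm (\<sigma> i (g x))) ` K)"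
    using K(1) by (intro compact_imp_bounded compact_continuous_image)
  then obtain B where B: "0 < B" "\<And>x. x \<in> K \<Longrightarrow> (\<Sum>i\<in>I. norm (\<sigma> i (g x))) \<le> B"
    unfolding bounded_pos by fastforce
  have "\<exists>P. real_polynomial_function P \<and> (\<forall>x\<in>K. \<bar>\<rho> i x - P x\<bar> < e / (4 * B))" if i: "i \<in> I" for i
    using Stone_Weierstrass_real_polynomial_function[OF K(1) continuous_on_subset[OF \<rho>_cont[OF i] U(2)], of "e / (4 * B)"]
      e B(1) by (metis divide_pos_pos mult_pos_pos zero_less_numeral)
  then obtain P where P: "\<And>i. i \<in> I \<Longrightarrow> real_polynomial_function (P i)"
    "\<And>i x. i \<in> I \<Longrightarrow> x \<in> K \<Longrightarrow> \<bar>\<rho> i x - P i x\<bar> < e / (4 * B)" by metis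
  define w where "w x = (\<Sum>i\<in>I. P i x *\<^sub>R \<sigma> i (g x))" for x
  have g': "regular_map X UNIV g" using regular_map_subset[OF g order_refl] by blast
  have "regular_map X UNIV w"
    unfolding w_def using P(1) \<sigma>(1) I(2)
    by (intro regular_map_sum regular_map_scaleR regular_function_polynomial
          regular_map_compose[OF g' regular_map_polynomial]) auto
  then have "regular_map X UNIV (\<lambda>x. (g x, w x))" by (rule regular_map_Pair[OF g'])
  moreover have "(g x, w x) \<in> S" if x: "x \<in> X" for x
  proof -
    have sub: "subspace {w. (g x, w) \<in> S}"
      using S gY[OF x] unfolding algebraic_subbundle_def by blast
    have "w x \<in> {w. (g x, w) \<in> S}"
      unfolding w_def using \<sigma>(2) I(2) gY[OF x]
      by (intro subspace_sum[OF sub] subspace_scale[OF sub]) auto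
    then show ?thesis by simp
  qed
  ultimately have "regular_map X S (\<lambda>x. (g x, w x))"
    using regular_map_subset[of X UNIV "\<lambda>x. (g x, w x)" X S] by blast
  moreover have "norm (w x - v x) < e" if x: "x \<in> K" for x
  proof -
    have xU: "x \<in> U" using x U by blast
    have "norm ((\<Sum>i\<in>I. \<rho> i x *\<^sub>R \<sigma> i (g x)) - v x) \<le> e / 2"
      by (rule convex_combination_norm_le)
         (use \<rho>_sum[OF xU] \<rho>_nonneg[OF _ xU] \<rho>_supp[OF _ xU] r(2)[OF _ x] I(2) in \<open>auto simp: dist_commute\<close>)
    moreover have "w x - (\<Sum>i\<in>I. \<rho> i x *\<^sub>R \<sigma> i (g x)) = (\<Sum>i\<in>I. (P i x - \<rho> i x) *\<^sub>R \<sigma> i (g x))"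
      unfolding w_def by (simp add: scaleR_diff_left sum_subtractf)
    moreover have "norm (\<Sum>i\<in>I. (P i x - \<rho> i x) *\<^sub>R \<sigma> i (g x)) \<le> e / 4"
    proof -
      have "norm (\<Sum>i\<in>I. (P i x - \<rho> i x) *\<^sub>R \<sigma> i (g x)) \<le> (\<Sum>i\<in>I. e / (4 * B) * norm (\<sigma> i (g x)))"
      proof (rule sum_norm_le)
        fix i assume "i \<in> I"
        then have "\<bar>P i x - \<rho> i x\<bar> \<le> e / (4 * B)"
          using P(2)[OF _ x] by (simp add: abs_minus_commute less_imp_le)
        then show "norm ((P i x - \<rho> i x) *\<^sub>R \<sigma> i (g x)) \<le> e / (4 * B) * norm (\<sigma> i (g x))"
          unfolding norm_scaleR real_norm_def by (rule mult_right_mono) simp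
      qed
      also have "\<dots> = e / (4 * B) * (\<Sum>i\<in>I. norm (\<sigma> i (g x)))" by (simp add: sum_distrib_left)
      also have "\<dots> \<le> e / (4 * B) * B" using B e x by (intro mult_left_mono) auto
      finally show ?thesis using B(1) by simp
    qed
    ultimately show ?thesis
      using norm_diff_triangle_le[of "w x" "\<Sum>i\<in>I. \<rho> i x *\<^sub>R \<sigma> i (g x)" "e / 4" "v x" "e / 2"] e
      by simp
  qed
  ultimately show ?thesis by (rule that)
qed

section \<open>Following a homotopy by regular maps\<close>

text \<open>
  A regular approximation of a continuous section takes its values near a compact part of \<open>S\<close> but not in it, so
  uniform continuity on the compact part alone would not control the change of \<open>T\<close>.
\<close>

lemma continuous_on_uniform_near_compact:
  fixes T :: "'a::metric_space \<Rightarrow> 'b::metric_space"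
  assumes "continuous_on S T" "compact C" "C \<subseteq> S" "0 < e"
  obtains d where "0 < d" "\<And>c q. c \<in> C \<Longrightarrow> q \<in> S \<Longrightarrow> dist c q < d \<Longrightarrow> dist (T c) (T q) < e"
proof -
  define \<G> where "\<G> = {G. open G \<and> (\<forall>p\<in>S \<inter> G. \<forall>q\<in>S \<inter> G. dist (T p) (T q) < e)}"
  have "C \<subseteq> \<Union>\<G>"
  proof
    fix c assume c: "c \<in> C"
    then have "c \<in> S" using assms(3) by blast
    from assms(1)[unfolded continuous_on_iff, rule_format, OF this, of "e / 2"] assms(4)
    obtain r where r: "r > 0" "\<forall>q\<in>S. dist q c < r \<longrightarrow> dist (T q) (T c) < e / 2"
      by auto
    have "ball c r \<in> \<G>"
      unfolding \<G>_def using r(2) by (auto simp: dist_commute intro: dist_triangle_half_l[of _ "T c"])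
    then show "c \<in> \<Union>\<G>" using r(1) by (auto intro!: bexI[of _ "ball c r"])
  qed
  moreover have "open G" if "G \<in> \<G>" for G using that unfolding \<G>_def by blast
  ultimately obtain d where d: "0 < d" "\<And>c. c \<in> C \<Longrightarrow> \<exists>G\<in>\<G>. ball c d \<subseteq> G"
    by (rule Heine_Borel_lemma[OF assms(2)]) (assumption, rule that)
  show ?thesis
  proof (rule that[OF d(1)])
    fix c q assume cq: "c \<in> C" "q \<in> S" "dist c q < d"
    then obtain G where G: "G \<in> \<G>" "ball c d \<subseteq> G" using d(2) by blast
    have "c \<in> S \<inter> G" "q \<in> S \<inter> G" using cq d(1) G(2) assms(3) by auto
    then show "dist (T c) (T q) < e" using G(1) unfolding \<G>_def by blast
  qed
qed

text \<open>
  The exact choice \<open>w x = v (g x) (h x)\<close> would halve the distance to \<open>h\<close>, but it is only continuous and only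
  given on \<open>K\<close>. A regular approximation of it, good enough to change \<open>T\<close> by less than \<open>r / 4\<close>, gives the
  factor \<open>1/2 + 1/4\<close>.
\<close>

lemma regular_approximation_contracts:
  fixes X K :: "'x::euclidean_space set" and Y :: "'y::euclidean_space set"
    and S :: "('y \<times> 'k::euclidean_space) set"
  assumes S: "algebraic_subbundle Y S" and T: "regular_map S Y T"
    and v_cont: "continuous_on {(y, z). y \<in> Y \<and> z \<in> L \<and> dist y z < d} (\<lambda>(y, z). v y z)"
    and v: "\<And>y z. y \<in> Y \<Longrightarrow> z \<in> L \<Longrightarrow> dist y z < d \<Longrightarrow>
       (y, v y z) \<in> S \<and> dist (T (y, v y z)) z \<le> dist y z / 2"
    and K: "compact K" "K \<subseteq> X" and h: "continuous_on K h" "h ` K \<subseteq> L"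
    and g: "regular_map X Y g" "\<And>x. x \<in> K \<Longrightarrow> dist (g x) (h x) \<le> r" and r: "0 < r" "r < d"
  obtains g' where "regular_map X Y g'" "\<And>x. x \<in> K \<Longrightarrow> dist (g' x) (h x) \<le> 3 / 4 * r"
proof -
  have g_cont: "continuous_on K g"
    using regular_map_continuous_on[OF g(1)] K(2) by (rule continuous_on_subset)
  have gh: "g x \<in> Y" "h x \<in> L" "dist (g x) (h x) < d" if "x \<in> K" for x
  proof -
    show "g x \<in> Y" using g(1) K(2) that unfolding regular_map_def by blast
    show "h x \<in> L" using h(2) that by blast
    show "dist (g x) (h x) < d" using g(2)[OF that] r(2) by linarith
  qed
  define u where "u x = v (g x) (h x)" for x
  have "continuous_on K (\<lambda>x. case (g x, h x) of (y, z) \<Rightarrow> v y z)"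
    by (rule continuous_on_compose2[OF v_cont]) (use g_cont h(1) gh in \<open>auto intro!: continuous_intros\<close>)
  then have u_cont: "continuous_on K u" unfolding u_def by simp
  have uS: "(g x, u x) \<in> S" "dist (T (g x, u x)) (h x) \<le> r / 2" if "x \<in> K" for x
    using v[OF gh[OF that]] g(2)[OF that] unfolding u_def by auto
  have "compact ((\<lambda>x. (g x, u x)) ` K)"
    by (intro compact_continuous_image K(1) continuous_intros g_cont u_cont)
  then obtain \<epsilon> where \<epsilon>: "0 < \<epsilon>" "\<And>c q. c \<in> (\<lambda>x. (g x, u x)) ` K \<Longrightarrow> q \<in> S \<Longrightarrow>
      dist c q < \<epsilon> \<Longrightarrow> dist (T c) (T q) < r / 4"
    by (rule continuous_on_uniform_near_compact[OF regular_map_continuous_on[OF T], where e = "r / 4"])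
       (use uS r(1) in auto)
  obtain w where w: "regular_map X S (\<lambda>x. (g x, w x))" "\<And>x. x \<in> K \<Longrightarrow> norm (w x - u x) < \<epsilon>"
    by (rule regular_approximation_of_section[OF S g(1) K u_cont uS(1) \<epsilon>(1)]) (simp, rule that)
  show ?thesis
  proof
    show "regular_map X Y (\<lambda>x. T (g x, w x))"
      by (rule regular_map_compose[OF w(1) T])
    fix x assume x: "x \<in> K"
    have "(g x, w x) \<in> S" using w(1) K(2) x unfolding regular_map_def by blast
    moreover have "dist (g x, u x) (g x, w x) < \<epsilon>"
      using w(2)[OF x] by (simp add: dist_Pair_Pair dist_norm norm_minus_commute)
    ultimately have "dist (T (g x, u x)) (T (g x, w x)) < r / 4"
      using \<epsilon>(2) x by blast
    then show "dist (T (g x, w x)) (h x) \<le> 3 / 4 * r"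
      using uS(2)[OF x] dist_triangle3[of "T (g x, w x)" "h x" "T (g x, u x)"] by linarith
  qed
qed

lemma algebraic_set_closed:
  assumes "algebraic_set Y"
  shows "closed Y"
proof -
  obtain \<P> where P: "\<forall>P\<in>\<P>. real_polynomial_function P" "Y = {x. \<forall>P\<in>\<P>. P x = 0}"
    using assms unfolding algebraic_set_def by blast
  have "closed (\<Inter>P\<in>\<P>. {x. P x = 0})"
  proof (intro closed_INT ballI closed_Collect_eq continuous_on_const)
    fix P assume "P \<in> \<P>"
    then show "continuous_on UNIV P"
      using P(1) by (simp add: continuous_on_polymonial_function real_polynomial_function_eq)
  qed
  then show ?thesis unfolding P(2) by (simp add: INTER_eq)
qed

lemma bounded_open_rel_compact:
  assumes "closed Y"
  shows "Y \<inter> ball 0 R \<in> rel_compact_opens Y"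
proof -
  have "top_of_set Y closure_of (Y \<inter> ball 0 R) = Y \<inter> closure (Y \<inter> ball 0 R)"
    by (simp add: closure_of_subtopology)
  moreover have "compact (Y \<inter> closure (Y \<inter> ball 0 R))"
    using assms by (intro closed_Int_compact compact_closure[THEN iffD2] bounded_Int) auto
  ultimately show ?thesis
    unfolding rel_compact_opens_def by (auto simp: compactin_subtopology openin_open_Int)
qed

text \<open>
  Let \<open>L\<close> be the compact set swept by the homotopy and \<open>d\<close> the radius belonging to it. Cut the unit interval into
  \<open>N\<close> parts along which the homotopy moves by at most \<open>d / 4\<close>. A regular map within \<open>d / 4\<close> of the \<open>i\<close>-th map is
  within \<open>d / 2\<close> of the next one, and repeated contraction makes that distance arbitrarily small.
\<close>

lemma regular_approximation_along_homotopy: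
  fixes X K :: "'x::euclidean_space set" and Y :: "'y::euclidean_space set"
    and H :: "real \<times> 'x \<Rightarrow> 'y"
  assumes Y: "algebraic_set Y"
    and malleable: "quasi_malleable TYPE('e::euclidean_space) TYPE('k::euclidean_space) Y"
    and K: "compact K" "K \<subseteq> X"
    and H: "continuous_on ({0..1} \<times> K) H" "H ` ({0..1} \<times> K) \<subseteq> Y"
    and g0: "regular_map X Y g\<^sub>0" "\<And>x. x \<in> K \<Longrightarrow> H (0, x) = g\<^sub>0 x"
    and e: "0 < e"
  obtains g where "regular_map X Y g" "\<And>x. x \<in> K \<Longrightarrow> dist (g x) (H (1, x)) < e"
proof -
  define L where "L = H ` ({0..1} \<times> K)"
  have L: "compact L"
    unfolding L_def by (intro compact_continuous_image H(1) compact_Times K(1)) simp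
  then obtain R where R: "L \<subseteq> ball 0 R"
    using bounded_subset_ballD[OF compact_imp_bounded] by blast
  define V where "V = Y \<inter> ball 0 R"
  have LV: "L \<subseteq> V" using R H(2) unfolding V_def L_def by blast
  have V: "V \<in> rel_compact_opens Y"
    unfolding V_def by (rule bounded_open_rel_compact[OF algebraic_set_closed[OF Y]])
  obtain S :: "('y \<times> 'k) set" and T \<omega>
    where S: "algebraic_subbundle Y S" and T: "regular_map S Y T" and \<omega>: "continuous_on V \<omega>"
    "\<And>y. y \<in> V \<Longrightarrow> (y, \<omega> y) \<in> S \<and> T (y, \<omega> y) = y"
    "\<And>y u. y \<in> V \<Longrightarrow> u \<in> tangent_space Y y \<Longrightarrow>
       \<exists>w. (y, w) \<in> S \<and> ((\<lambda>t. T (y, \<omega> y + t *\<^sub>R w)) has_vector_derivative u) (at 0)"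
    by (rule dominating_quasi_spray_on_subbundle[OF malleable V]) (rule that)
  obtain M where M: "increment_matrix S T M" by (rule regular_map_increment[OF T])
  interpret dominating_fibre_map Y V S T \<omega> M
    by unfold_locales (use S \<omega> M V in \<open>auto simp: rel_compact_opens_def\<close>)
  obtain d v where d: "0 < d"
    and v: "continuous_on {(y, z). y \<in> Y \<and> z \<in> L \<and> dist y z < d} (\<lambda>(y, z). v y z)"
    "\<And>y z. y \<in> Y \<Longrightarrow> z \<in> L \<Longrightarrow> dist y z < d \<Longrightarrow>
       (y, v y z) \<in> S \<and> dist (T (y, v y z)) z \<le> dist y z / 2"
    by (rule approximate_lift_near_diagonal[OF L LV]) (rule that)
  define approx where "approx h e \<longleftrightarrow> (\<exists>g. regular_map X Y g \<and> (\<forall>x\<in>K. dist (g x) (h x) \<le> e))"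
    for h :: "'x \<Rightarrow> 'y" and e :: real
  have improve: "approx h e'" if h: "continuous_on K h" "h ` K \<subseteq> L" "approx h r" and r: "0 < r" "r < d"
    and e': "0 < e'" for h r e'
  proof -
    have "approx h ((3/4) ^ n * r)" for n
    proof (induction n)
      case 0
      then show ?case using h by simp
    next
      case (Suc n)
      then obtain g where g: "regular_map X Y g" "\<forall>x\<in>K. dist (g x) (h x) \<le> (3/4) ^ n * r"
        unfolding approx_def by blast
      have "(3/4) ^ n * r \<le> 1 * r" using r by (intro mult_right_mono power_le_one) auto
      then have lt: "(3/4) ^ n * r < d" using r by linarith
      have "0 < (3/4) ^ n * r" using r by simp
      then obtain g' where "regular_map X Y g'" "\<And>x. x \<in> K \<Longrightarrow> dist (g' x) (h x) \<le> 3 / 4 * ((3/4) ^ n * r)"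
        using regular_approximation_contracts[OF S T v K h(1,2) g(1) g(2)[rule_format] _ lt] by metis
      then show ?case unfolding approx_def by (auto simp: mult.assoc)
    qed
    moreover obtain n where "(3/4::real) ^ n < e' / r"
      using real_arch_pow_inv[of "e' / r" "3/4"] e' r by auto
    then have "(3/4) ^ n * r \<le> e'" using r by (simp add: field_simps)
    ultimately show ?thesis unfolding approx_def by (meson order_trans)
  qed
  have "uniformly_continuous_on ({0..1} \<times> K) H"
    by (intro compact_uniformly_continuous H(1) compact_Times K(1)) simp
  then obtain \<delta> where \<delta>: "0 < \<delta>" "\<And>p q. p \<in> {0..1} \<times> K \<Longrightarrow> q \<in> {0..1} \<times> K \<Longrightarrow>
      dist q p < \<delta> \<Longrightarrow> dist (H q) (H p) < d / 4"
    unfolding uniformly_continuous_on_def using d by (metis divide_pos_pos zero_less_numeral)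
  obtain N :: nat where N: "0 < N" "1 / N < \<delta>"
    using \<delta>(1) by (metis nat_approx_posE of_nat_0_less_iff zero_less_Suc)
  define h where "h i x = H (real i / N, x)" for i x
  have h: "continuous_on K (h i)" "h i ` K \<subseteq> L" if "i \<le> N" for i
  proof -
    have i: "real i / N \<in> {0..1}" using that N(1) by simp
    show "continuous_on K (h i)"
      unfolding h_def
      by (rule continuous_on_compose2[OF H(1)]) (use i in \<open>auto intro!: continuous_intros\<close>)
    show "h i ` K \<subseteq> L"
      unfolding h_def L_def using i by auto
  qed
  have "i \<le> N \<Longrightarrow> \<forall>e'>0. approx (h i) e'" for i
  proof (induction i)
    case 0
    then show ?case unfolding approx_def h_def using g0 by (auto intro!: exI[of _ "g\<^sub>0"])
  next
    case (Suc i)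
    then have i: "real i / N \<in> {0..1}" "real (Suc i) / N \<in> {0..1}" using N(1) by auto
    have step: "dist (h i x) (h (Suc i) x) \<le> d / 4" if x: "x \<in> K" for x
    proof -
      have "dist (real i / N, x) (real (Suc i) / N, x) = 1 / N"
        using N(1) by (simp add: dist_Pair_Pair dist_real_def add_divide_distrib)
      then show ?thesis
        using \<delta>(2)[of "(real (Suc i) / N, x)" "(real i / N, x)"] i x N(2) unfolding h_def by auto
    qed
    obtain g where g: "regular_map X Y g" "\<forall>x\<in>K. dist (g x) (h i x) \<le> d / 4"
      using Suc d unfolding approx_def by (auto dest!: spec[of _ "d / 4"])
    have "dist (g x) (h (Suc i) x) \<le> d / 2" if "x \<in> K" for x
      using step[OF that] g(2) that dist_triangle[of "g x" "h (Suc i) x" "h i x"] by fastforce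
    then have "approx (h (Suc i)) (d / 2)" using g(1) unfolding approx_def by blast
    then show ?case using improve[OF h[OF Suc.prems]] d by simp
  qed
  then have "approx (h N) (e / 2)" using e by simp
  then obtain g where "regular_map X Y g" "\<forall>x\<in>K. dist (g x) (H (1, x)) \<le> e / 2"
    unfolding approx_def h_def using N(1) by auto
  then show ?thesis using e by (intro that[of g]) force+
qed

section \<open>Neighbourhoods in the compact-open topology\<close>

text \<open>
  Uniform closeness on a single compact set is enough: for a subbasic set given by \<open>K\<close> and \<open>W\<close>, the compact set
  \<open>f ` K\<close> has positive distance to the complement of \<open>W\<close> in \<open>Y\<close>, and finitely many conditions combine by
  taking the union of the compact sets and the least of the radii.
\<close>

lemma compact_open_topology_neighbourhood:
  fixes f :: "'a::topological_space \<Rightarrow> 'b::metric_space"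
  assumes "openin (compact_open_topology D Y) \<U>" "restrict f D \<in> \<U>" "continuous_on D f"
  obtains K e where "compact K" "K \<subseteq> D" "0 < e"
    "\<And>g. continuous_on D g \<Longrightarrow> g \<in> D \<rightarrow> Y \<Longrightarrow> (\<And>x. x \<in> K \<Longrightarrow> dist (g x) (f x) < e) \<Longrightarrow> restrict g D \<in> \<U>"
proof -
  have "\<exists>K e. compact K \<and> K \<subseteq> D \<and> 0 < e \<and>
    (\<forall>g. continuous_on D g \<longrightarrow> g \<in> D \<rightarrow> Y \<longrightarrow> (\<forall>x\<in>K. dist (g x) (f x) < e) \<longrightarrow> restrict g D \<in> \<U>)"
    using openin_topology_generated_by[OF assms(1)[unfolded compact_open_topology_def]] assms(2)
  proof induction
    case Empty
    then show ?case by simp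
  next
    case (Int a b)
    from Int.prems have "restrict f D \<in> a" "restrict f D \<in> b" by blast+
    with Int.IH obtain K e K' e' where "compact K" "K \<subseteq> D" "0 < e"
      "\<forall>g. continuous_on D g \<longrightarrow> g \<in> D \<rightarrow> Y \<longrightarrow> (\<forall>x\<in>K. dist (g x) (f x) < e) \<longrightarrow> restrict g D \<in> a"
      "compact K'" "K' \<subseteq> D" "0 < e'"
      "\<forall>g. continuous_on D g \<longrightarrow> g \<in> D \<rightarrow> Y \<longrightarrow> (\<forall>x\<in>K'. dist (g x) (f x) < e') \<longrightarrow> restrict g D \<in> b"
      by blast
    then show ?case
      by (intro exI[of _ "K \<union> K'"] exI[of _ "min e e'"]) (simp add: compact_Un del: restrict_apply)
  next
    case (UN \<K>)
    from UN.prems obtain k where k: "k \<in> \<K>" "restrict f D \<in> k" by blast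
    from UN.IH[OF k] obtain K e where "compact K" "K \<subseteq> D" "0 < e"
      "\<forall>g. continuous_on D g \<longrightarrow> g \<in> D \<rightarrow> Y \<longrightarrow> (\<forall>x\<in>K. dist (g x) (f x) < e) \<longrightarrow> restrict g D \<in> k"
      by blast
    then show ?case
      using k(1) by (intro exI[of _ K] exI[of _ e]) blast
  next
    case (Basis s)
    then obtain K W where s: "s = {f \<in> continuous_maps D Y. f ` K \<subseteq> W}" and K: "compact K" "K \<subseteq> D"
      and W: "openin (top_of_set Y) W" by blast
    obtain B where B: "open B" "W = Y \<inter> B" using W unfolding openin_open by blast
    have "restrict f D ` K = f ` K" using K(2) by (auto simp: subset_iff)
    then have "f ` K \<subseteq> B" using Basis.prems s B(2) by auto
    moreover have "compact (f ` K)"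
      using K assms(3) by (intro compact_continuous_image continuous_on_subset[OF assms(3)]) auto
    ultimately obtain e where e: "0 < e" "(\<Union>x\<in>f ` K. ball x e) \<subseteq> B"
      using compact_subset_open_imp_ball_epsilon_subset[OF _ B(1)] by metis
    show ?case
    proof (intro exI[of _ K] exI[of _ e] conjI allI impI)
      fix g assume g: "continuous_on D g" "g \<in> D \<rightarrow> Y" "\<forall>x\<in>K. dist (g x) (f x) < e"
      have "restrict g D \<in> continuous_maps D Y"
        unfolding continuous_maps_def using g(1,2) by (auto cong: continuous_on_cong)
      moreover have "g x \<in> W" if "x \<in> K" for x
      proof -
        have "g x \<in> ball (f x) e" using g(3) that by (simp add: dist_commute)
        then show ?thesis using e(2) B(2) g(2) K(2) that by blast
      qed
      ultimately show "restrict g D \<in> s" unfolding s using K(2) by (auto simp: subset_iff)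
    qed (use K e in auto)
  qed
  then show ?thesis by (elim exE conjE) (rule that; blast)
qed

theorem theorem1p12:
  fixes X D :: "'x::euclidean_space set"
    and Y :: "'y::euclidean_space set"
    and f f\<^sub>0 :: "'x \<Rightarrow> 'y"
  assumes "algebraic_set Y" and "nonsingular Y"
    and "quasi_malleable TYPE('e::euclidean_space) TYPE('k::euclidean_space) Y"
    and "algebraic_set X"
    and "D \<subseteq> X"
    and "continuous_on D f" and "f \<in> D \<rightarrow> Y"
    and "regular_map X Y f\<^sub>0"
    and "homotopic_with_canon (\<lambda>_. True) D Y f\<^sub>0 f"
  shows "approximable_by_regular_maps X D Y f"
  unfolding approximable_by_regular_maps_def
proof (intro allI impI, elim conjE)
  fix \<U> assume "openin (compact_open_topology D Y) \<U>" "restrict f D \<in> \<U>"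
  then obtain K e where K: "compact K" "K \<subseteq> D" and e: "0 < e"
    and nbhd: "\<And>g. continuous_on D g \<Longrightarrow> g \<in> D \<rightarrow> Y \<Longrightarrow> (\<And>x. x \<in> K \<Longrightarrow> dist (g x) (f x) < e) \<Longrightarrow> restrict g D \<in> \<U>"
    using compact_open_topology_neighbourhood[OF _ _ assms(6)] by metis
  obtain H where H: "continuous_on ({0..1::real} \<times> D) H" "H \<in> {0..1} \<times> D \<rightarrow> Y"
    "\<forall>x. H (0, x) = f\<^sub>0 x" "\<forall>x. H (1, x) = f x"
    using assms(9) unfolding homotopic_with_def prod_topology_subtopology_eu
    by (auto simp: continuous_map_subtopology_eu intro: that)
  obtain g where g: "regular_map X Y g" "\<And>x. x \<in> K \<Longrightarrow> dist (g x) (H (1, x)) < e"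
  proof (rule regular_approximation_along_homotopy[OF assms(1,3) K(1) _ _ _ assms(8) _ e])
    show "K \<subseteq> X" using K(2) assms(5) by blast
    show "continuous_on ({0..1} \<times> K) H" by (rule continuous_on_subset[OF H(1)]) (use K(2) in blast)
    show "H ` ({0..1} \<times> K) \<subseteq> Y" using H(2) K(2) by blast
    show "H (0, x) = f\<^sub>0 x" if "x \<in> K" for x using H(3) by blast
  qed (rule that)
  have "restrict g D \<in> \<U>"
  proof (rule nbhd)
    show "continuous_on D g" using regular_map_continuous_on[OF g(1)] assms(5) by (rule continuous_on_subset)
    show "g \<in> D \<rightarrow> Y" using g(1) assms(5) unfolding regular_map_def by blast
    show "dist (g x) (f x) < e" if "x \<in> K" for x using g(2)[OF that] H(4) by auto
  qed
  with g(1) show "\<exists>g. regular_map X Y g \<and> restrict g D \<in> \<U>" by blast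
qed

end
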